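(* Let $m\le n$, let $M\in\mathbb{R}^{m\times n}$ have rank $r\ge 1$ with singular values $\sigma_1\ge\cdots\ge\sigma_m$, let $\mathcal{A}:\mathbb{R}^{m\times n}\to\mathbb{R}^p$ be linear, let $\nu,\mu>0$, and let $\kappa\ge 1$ be an integer. Let $f(X)=\frac12\|\mathcal{A}(X)-\mathcal{A}(M)\|^2$ and, for $(U,V)\in\mathbb{R}^{m\times\kappa}\times\mathbb{R}^{n\times\kappa}$, $$\Psi(U,V)=\nu f(UV^{\mathbb{T}})+\frac{\mu}{4}\|U^{\mathbb{T}}U-V^{\mathbb{T}}V\|_F^2+\frac12\big(\|U\|_{2,0}+\|V\|_{2,0}\big).$$ Let $\alpha$ and $\beta$ be the $2r$-restricted smallest and largest eigenvalues of $\mathcal{A}^*\mathcal{A}$, respectively. Suppose that $\mathcal{X}^*\cap\Omega_\kappa\neq\emptyset$ and $$\frac{\beta}{\alpha}<\frac{128\sigma_1^2(4\sigma_1+\sigma_r)^2+\sigma_r^4}{128\sigma_1^2(4\sigma_1+\sigma_r)^2-\sigma_r^4}\quad\text{with}\quad \alpha>\frac{4}{\nu\sigma_r^2}.$$ Fix an arbitrary $(\overline{U},\overline{V})\in\mathcal{W}^*$. Then for any $(U,V)\in\mathbb{R}^{m\times\kappa}\times\mathbb{R}^{n\times\kappa}$ with $\|[U-\overline{U}\ \ V-\overline{V}]\|_F<\frac{\sqrt{\sigma_r}}{4}$ and $0<\Psi(U,V)-\Psi(\overline{U},\overline{V})<\frac12$, $${\rm dist}^2(0,\partial\Psi(U,V))\ge\gamma\big[\Psi(U,V)-\Psi(\overline{U},\overline{V})\big],$$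 where $$\gamma=\min\bigg(\frac{\nu}{\beta}\Big[\frac{(\beta+\alpha)\sigma_r^4}{128\sqrt{\sigma_1^3}(4\sigma_1+\sigma_r)^2}-\sqrt{\sigma_1}(\beta-\alpha)\Big]^2,\ 2\mu\sigma_r\bigg).$$
   Context: $\|\cdot\|_F$ is the Frobenius norm; $\|U\|_{2,0}$ is the number of nonzero columns of $U$; $\Omega_k:=\{X\in\mathbb{R}^{m\times n}: {\rm rank}(X)\le k\}$. $\mathcal{A}^*$ is the adjoint of $\mathcal{A}$. The $k$-restricted smallest and largest eigenvalues of $\mathcal{A}^*\mathcal{A}$ are $\min_{X\in\Omega_k,\|X\|_F=1}\|\mathcal{A}(X)\|^2$ and $\max_{X\in\Omega_k,\|X\|_F=1}\|\mathcal{A}(X)\|^2$. $\mathcal{X}^*$ is the (assumed nonempty) set of global optimal solutions of $\min_{X\in\mathbb{R}^{m\times n}}\{\nu f(X)+{\rm rank}(X)\}$. $\mathcal{W}^*$ is the set of $(\overline{U},\overline{V})\in\mathbb{R}^{m\times\kappa}\times\mathbb{R}^{n\times\kappa}$ with $\overline{U}\,\overline{V}^{\mathbb{T}}\in\mathcal{X}^*\cap\Omega_\kappa$, $\overline{U}^{\mathbb{T}}\overline{U}=\overline{V}^{\mathbb{T}}\overline{V}$ and $\|\overline{U}\|_{2,0}=\|\overline{V}\|_{2,0}={\rm rank}(\overline{U}\,\overline{V}^{\mathbb{T}})$. $\|[A\ \ B]\|_F$ for $A\in\mathbb{R}^{m\times\kappa}$, $B\in\mathbb{R}^{n\times\kappa}$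 means $(\|A\|_F^2+\|B\|_F^2)^{1/2}$, and ${\rm dist}$ is taken with respect to this norm on $\mathbb{R}^{m\times\kappa}\times\mathbb{R}^{n\times\kappa}$. $\partial$ denotes the limiting subdifferential: the regular subdifferential $\widehat\partial g(x)$ is the set of $v$ with $\liminf_{x'\to x,x'\ne x}\frac{g(x')-g(x)-\langle v,x'-x\rangle}{\|x'-x\|}\ge0$, and $\partial g(x)$ is the set of limits of sequences $v^k\in\widehat\partial g(x^k)$ with $x^k\to x$ and $g(x^k)\to g(x)$. *)

theory Defs
  imports "HOL-Analysis.Analysis"
begin

text \<open>
  The library norm on \<^typ>\<open>real^'n^'m\<close> is the Frobenius norm, and the library norm on a product of
  two such spaces is the square root of the sum of the squared Frobenius norms.
\<close>

text \<open>
  \<open>\<sigma> 1, \<dots>, \<sigma> m\<close> are the singular values of the matrix, with multiplicity and in nonincreasing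
  order, read off from a singular value decomposition
  \<open>M = \<Sum>i. \<sigma> i u i (v i)\<^sup>T\<close> with orthonormal \<open>u 1, \<dots>, u m\<close> and \<open>v 1, \<dots>, v m\<close>.
  This is meant for \<open>m \<le> n\<close>: otherwise the orthonormal \<open>v\<close> do not exist.
  Values of \<open>\<sigma>\<close> at indices outside \<open>{1..m}\<close> are unconstrained.
\<close>

definition singular_values :: "real^'n^'m \<Rightarrow> (nat \<Rightarrow> real) \<Rightarrow> bool" where
  "singular_values M \<sigma> \<longleftrightarrow>
     (\<forall>i\<in>{1..CARD('m)}. 0 \<le> \<sigma> i) \<and>
     (\<forall>i\<in>{1..CARD('m)}. \<forall>j\<in>{1..CARD('m)}. i \<le> j \<longrightarrow> \<sigma> j \<le> \<sigma> i) \<and>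
     (\<exists>(u :: nat \<Rightarrow> real^'m) (v :: nat \<Rightarrow> real^'n).
        (\<forall>i\<in>{1..CARD('m)}. \<forall>j\<in>{1..CARD('m)}.
           u i \<bullet> u j = (if i = j then 1 else 0) \<and> v i \<bullet> v j = (if i = j then 1 else 0)) \<and>
        M = (\<Sum>i = 1..CARD('m). \<sigma> i *\<^sub>R (\<chi> a b. u i $ a * v i $ b)))"

definition rank_le :: "nat \<Rightarrow> (real^'n^'m) set" where
  "rank_le k = {X. rank X \<le> k}"

text \<open>
  For \<open>k \<ge> 1\<close> and linear \<open>A\<close> the infimum and supremum are a minimum and a maximum: the unit
  Frobenius sphere of \<open>rank_le k\<close> is nonempty and compact.
\<close>

definition restricted_min_eigenvalue :: "nat \<Rightarrow> (real^'n^'m \<Rightarrow> real^'p) \<Rightarrow> real" where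
  "restricted_min_eigenvalue k A = (INF X\<in>{X \<in> rank_le k. norm X = 1}. (norm (A X))\<^sup>2)"

definition restricted_max_eigenvalue :: "nat \<Rightarrow> (real^'n^'m \<Rightarrow> real^'p) \<Rightarrow> real" where
  "restricted_max_eigenvalue k A = (SUP X\<in>{X \<in> rank_le k. norm X = 1}. (norm (A X))\<^sup>2)"

definition nonzero_columns :: "real^'k^'m \<Rightarrow> nat" where
  "nonzero_columns U = card {j. column j U \<noteq> 0}"

definition loss :: "(real^'n^'m \<Rightarrow> real^'p) \<Rightarrow> real^'n^'m \<Rightarrow> real^'n^'m \<Rightarrow> real" where
  "loss A M X = (norm (A X - A M))\<^sup>2 / 2"

definition rank_reg_solutions ::
    "real \<Rightarrow> (real^'n^'m \<Rightarrow> real^'p) \<Rightarrow> real^'n^'m \<Rightarrow> (real^'n^'m) set" where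
  "rank_reg_solutions \<nu> A M =
     {X. \<forall>Y. \<nu> * loss A M X + real (rank X) \<le> \<nu> * loss A M Y + real (rank Y)}"

definition factor_solutions ::
    "real \<Rightarrow> (real^'n^'m \<Rightarrow> real^'p) \<Rightarrow> real^'n^'m \<Rightarrow> ((real^'k^'m) \<times> (real^'k^'n)) set" where
  "factor_solutions \<nu> A M =
     {(U, V). U ** transpose V \<in> rank_reg_solutions \<nu> A M \<inter> rank_le CARD('k) \<and>
              transpose U ** U = transpose V ** V \<and>
              nonzero_columns U = rank (U ** transpose V) \<and>
              nonzero_columns V = rank (U ** transpose V)}"

definition Psi ::
    "real \<Rightarrow> real \<Rightarrow> (real^'n^'m \<Rightarrow> real^'p) \<Rightarrow> real^'n^'m \<Rightarrow> (real^'k^'m) \<times> (real^'k^'n) \<Rightarrow> real" where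
  "Psi \<nu> \<mu> A M = (\<lambda>(U, V).
     \<nu> * loss A M (U ** transpose V)
     + \<mu> / 4 * (norm (transpose U ** U - transpose V ** V))\<^sup>2
     + (real (nonzero_columns U) + real (nonzero_columns V)) / 2)"

definition regular_subdifferential :: "('a::real_inner \<Rightarrow> real) \<Rightarrow> 'a \<Rightarrow> 'a set" where
  "regular_subdifferential g x =
     {v. Liminf (at x) (\<lambda>y. ereal ((g y - g x - v \<bullet> (y - x)) / norm (y - x))) \<ge> 0}"

definition limiting_subdifferential :: "('a::real_inner \<Rightarrow> real) \<Rightarrow> 'a \<Rightarrow> 'a set" where
  "limiting_subdifferential g x =
     {v. \<exists>xs vs. (\<forall>k::nat. vs k \<in> regular_subdifferential g (xs k)) \<and>
                 xs \<longlonglongrightarrow> x \<and> (\<lambda>k. g (xs k)) \<longlonglongrightarrow> g x \<and> vs \<longlonglongrightarrow> v}"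

end

theory Submission
  imports Defs
begin

text \<open>
  Since \<open>\<alpha> > 4 / (\<nu> \<sigma>\<^sub>r\<^sup>2)\<close>, lowering the rank below \<open>r\<close> costs more in the loss than it gains, so \<open>M\<close> is the
  only global solution and \<open>Ubar Vbar\<^sup>T = M\<close>. Balancedness then makes the nonzero singular values of \<open>Ubar\<close>
  and \<open>Vbar\<close> the square roots of those of \<open>M\<close>. For \<open>(U, V)\<close> as in the theorem both factors have the column
  support of \<open>Ubar\<close>, so \<open>\<Psi>\<close> exceeds its optimal value by its smooth part \<open>\<Phi>\<close>, and every limiting
  subgradient agrees with \<open>\<nabla>\<Phi>\<close> on the directions with that support, in particular on \<open>\<nabla>\<Phi>(U, V)\<close> itself;
  hence the distance is at least the norm of \<open>\<nabla>\<Phi>(U, V)\<close>.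

  Let \<open>H = U V\<^sup>T - M\<close>, \<open>G = A\<^sup>*(A H)\<close> and \<open>E = U\<^sup>T U - V\<^sup>T V\<close>. As \<open>E\<close> is symmetric, the cross terms in
  \<open>\<parallel>\<nabla>\<Phi>\<parallel>\<^sup>2\<close> cancel, leaving \<open>\<nu>\<^sup>2 (\<parallel>G V\<parallel>\<^sup>2 + \<parallel>G\<^sup>T U\<parallel>\<^sup>2) + \<mu>\<^sup>2 (\<parallel>U E\<parallel>\<^sup>2 + \<parallel>V E\<parallel>\<^sup>2)\<close>. The restricted
  eigenvalues allow \<open>G\<close> to be replaced by \<open>(\<alpha> + \<beta>)/2 H\<close> up to an error of size \<open>\<beta> - \<alpha>\<close>, and
  \<open>\<parallel>H V\<parallel> + \<parallel>H\<^sup>T U\<parallel>\<close> dominates \<open>\<surd>\<sigma>\<^sub>r \<parallel>H\<parallel>\<close> because the part of \<open>H\<close> invisible to both \<open>U\<close> and \<open>V\<close> is of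
  second order.
\<close>

section \<open>Matrix algebra\<close>

lemma norm_sq_rows: "(norm (A::real^'b^'a))\<^sup>2 = (\<Sum>i\<in>UNIV. (norm (A$i))\<^sup>2)"
  by (simp add: norm_vec_def L2_set_def sum_nonneg)

lemma inner_matrix: "(A::real^'b^'a) \<bullet> B = (\<Sum>i\<in>UNIV. \<Sum>j\<in>UNIV. A$i$j * B$i$j)"
  by (simp add: inner_vec_def)

lemma inner_transpose: "transpose (A::real^'b^'a) \<bullet> transpose B = A \<bullet> B"
  unfolding inner_matrix transpose_def by (subst sum.swap) simp

lemma norm_transpose: "norm (transpose (A::real^'b^'a)) = norm A"
  by (simp add: norm_eq_sqrt_inner inner_transpose)

lemma inner_matrix_mult_left: "((X::real^'b^'a) ** Y) \<bullet> Z = Y \<bullet> (transpose X ** Z)"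
proof -
  have "(X ** Y) \<bullet> Z = (\<Sum>i\<in>UNIV. \<Sum>j\<in>UNIV. \<Sum>k\<in>UNIV. X$i$k * Y$k$j * Z$i$j)"
    by (simp add: inner_matrix matrix_matrix_mult_def sum_distrib_right)
  also have "\<dots> = (\<Sum>k\<in>UNIV. \<Sum>j\<in>UNIV. \<Sum>i\<in>UNIV. X$i$k * Y$k$j * Z$i$j)"
    by (subst sum.swap, subst (2) sum.swap, subst sum.swap) (rule refl)
  also have "\<dots> = Y \<bullet> (transpose X ** Z)"
    by (simp add: inner_matrix matrix_matrix_mult_def transpose_def sum_distrib_left mult_ac)
  finally show ?thesis .
qed

lemma inner_matrix_mult_right: "((X::real^'b^'a) ** Y) \<bullet> Z = X \<bullet> (Z ** transpose Y)"
proof -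
  have "(X ** Y) \<bullet> Z = (transpose Y ** transpose X) \<bullet> transpose Z"
    by (metis inner_transpose matrix_transpose_mul)
  also have "\<dots> = transpose X \<bullet> transpose (Z ** transpose Y)"
    by (simp add: inner_matrix_mult_left matrix_transpose_mul)
  finally show ?thesis by (simp only: inner_transpose)
qed

text \<open>Turns a right product with \<open>transpose U\<close> into \<open>U\<close> applied to
  each row, so that Frobenius-norm estimates follow row by row from vector estimates.\<close>

lemma row_mult_transpose: "(C ** transpose (U::real^'k^'a)) $ i = U *v (C $ i)"
  by (simp add: vec_eq_iff matrix_matrix_mult_def matrix_vector_mult_def transpose_def mult.commute)

lemma norm_matrix_vector_le: "norm ((A::real^'b^'a) *v x) \<le> norm A * norm x"
proof -
  have "(norm (A *v x))\<^sup>2 = (\<Sum>i\<in>UNIV. (A$i \<bullet> x)\<^sup>2)"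
    by (simp add: norm_vec_def L2_set_def sum_nonneg matrix_mult_dot)
  also have "\<dots> \<le> (\<Sum>i\<in>UNIV. (norm (A$i))\<^sup>2 * (norm x)\<^sup>2)"
    by (intro sum_mono) (metis Cauchy_Schwarz_ineq power2_norm_eq_inner)
  also have "\<dots> = (norm A * norm x)\<^sup>2"
    by (simp add: norm_sq_rows sum_distrib_right power_mult_distrib)
  finally show ?thesis by (rule power2_le_imp_le) simp
qed

lemma norm_le_rows:
  assumes "\<And>i. norm ((A::real^'b^'a)$i) \<le> c * norm ((B::real^'d^'a)$i)" and c: "c \<ge> 0"
  shows "norm A \<le> c * norm B"
proof -
  have "(norm A)\<^sup>2 \<le> (\<Sum>i\<in>UNIV. (c * norm (B$i))\<^sup>2)"
    unfolding norm_sq_rows by (intro sum_mono power_mono assms) auto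
  also have "\<dots> = (c * norm B)\<^sup>2"
    by (simp add: power_mult_distrib norm_sq_rows sum_distrib_left)
  finally show ?thesis by (rule power2_le_imp_le) (simp add: c)
qed

lemma norm_matrix_mult_le: "norm ((A::real^'b^'a) ** (B::real^'c^'b)) \<le> norm A * norm B"
proof -
  have "norm ((A ** transpose (transpose B)) $ i) \<le> norm (transpose B) * norm (A $ i)" for i
    unfolding row_mult_transpose by (rule norm_matrix_vector_le)
  from norm_le_rows[OF this] show ?thesis by (simp add: norm_transpose mult.commute)
qed

lemma bounded_bilinear_matrix_mult:
  "bounded_bilinear ((**) :: real^'b^'a \<Rightarrow> real^'c^'b \<Rightarrow> real^'c^'a)"
proof
  fix A A' :: "real^'b^'a" and B B' :: "real^'c^'b" and r :: real
  show "(A + A') ** B = A ** B + A' ** B"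
    by (simp add: vec_eq_iff matrix_matrix_mult_def distrib_right sum.distrib)
  show "A ** (B + B') = A ** B + A ** B'" by (rule matrix_add_ldistrib)
  show "(r *\<^sub>R A) ** B = r *\<^sub>R (A ** B)" by (simp add: scalar_matrix_assoc)
  show "A ** (r *\<^sub>R B) = r *\<^sub>R (A ** B)" by (simp add: matrix_scalar_ac scalar_matrix_assoc)
  show "\<exists>K. \<forall>a b. norm ((a::real^'b^'a) ** (b::real^'c^'b)) \<le> norm a * norm b * K"
    by (rule exI[of _ 1]) (simp add: norm_matrix_mult_le)
qed

interpretation matrix_mult: bounded_bilinear "(**) :: real^'b^'a \<Rightarrow> real^'c^'b \<Rightarrow> real^'c^'a"
  by (rule bounded_bilinear_matrix_mult)

lemma bounded_linear_transpose: "bounded_linear (transpose :: real^'b^'a \<Rightarrow> real^'a^'b)"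
  by (rule bounded_linear_intro[where K=1])
     (simp_all add: vec_eq_iff transpose_def norm_transpose[unfolded transpose_def])

lemmas transpose_add = bounded_linear_transpose[THEN bounded_linear.linear, THEN linear_add]
lemmas transpose_diff = bounded_linear_transpose[THEN bounded_linear.linear, THEN linear_diff]

lemma rank_add_le: "rank ((A::real^'b^'a) + B) \<le> rank A + rank B"
proof -
  let ?S = "range ((*v) A)" and ?T = "range ((*v) B)"
  have sub: "subspace ?S" "subspace ?T"
    by (simp_all add: linear_subspace_image)
  have "range ((*v) (A + B)) \<subseteq> {x + y |x y. x \<in> ?S \<and> y \<in> ?T}"
    by (auto simp: matrix_vector_mult_add_rdistrib)
  then have "dim (range ((*v) (A + B))) \<le> dim {x + y |x y. x \<in> ?S \<and> y \<in> ?T}"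
    by (rule dim_subset)
  also have "\<dots> \<le> dim ?S + dim ?T"
    using dim_sums_Int[OF sub] by linarith
  finally show ?thesis by (simp add: rank_dim_range)
qed

lemma rank_scaleR_le: "rank (c *\<^sub>R (A::real^'b^'a)) \<le> rank A"
  using rank_mul_le_right[of "c *\<^sub>R mat 1" A] by (simp flip: scalar_matrix_assoc)

lemma rank_diff_le: "rank ((A::real^'b^'a) - B) \<le> rank A + rank B"
  using rank_add_le[of A "(-1) *\<^sub>R B"] rank_scaleR_le[of "-1" B] by simp

section \<open>Column supports and rank\<close>

definition colsupp :: "real^'k^'m \<Rightarrow> 'k set" where
  "colsupp U = {j. column j U \<noteq> 0}"

lemma nonzero_columns_colsupp: "nonzero_columns U = card (colsupp U)"
  by (simp add: nonzero_columns_def colsupp_def)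

lemma rank_le_nonzero_columns: "rank (U::real^'k^'m) \<le> nonzero_columns U"
proof -
  let ?J = "{j. column j U \<noteq> 0}"
  have "columns U \<subseteq> span ((\<lambda>j. column j U) ` ?J)"
  proof
    fix x assume "x \<in> columns U"
    then obtain j where "x = column j U" by (auto simp: columns_def)
    then show "x \<in> span ((\<lambda>j. column j U) ` ?J)"
      by (cases "x = 0") (auto intro: span_base span_zero)
  qed
  then have "dim (columns U) \<le> card ((\<lambda>j. column j U) ` ?J)"
    by (rule dim_le_card) simp
  also have "\<dots> \<le> card ?J" by (rule card_image_le) simp
  finally show ?thesis by (simp add: column_rank_def nonzero_columns_def)
qed

section \<open>Errors of factorizations\<close>

lemma norm_ge_rows:
  assumes "\<And>i. c * norm ((A::real^'b^'a)$i) \<le> norm ((B::real^'d^'a)$i)" and "c \<ge> 0"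
  shows "c * norm A \<le> norm B"
  using norm_le_rows[of "c *\<^sub>R A" 1 B] assms by simp

text \<open>A lower bound for the smallest singular value of the submatrix of \<open>U\<close> with
  columns in \<open>J\<close>. Restricting the coefficients to \<open>J\<close> keeps this
  meaningful when \<open>U\<close> has zero columns.\<close>

definition bounded_below_on :: "'k set \<Rightarrow> real \<Rightarrow> real^'k^'m \<Rightarrow> bool" where
  "bounded_below_on J \<tau> U \<longleftrightarrow> (\<forall>c. (\<forall>j. j \<notin> J \<longrightarrow> c$j = 0) \<longrightarrow> \<tau> * norm c \<le> norm (U *v c))"

lemma norm_mult_transpose_ge:
  assumes "bounded_below_on J \<tau> U" "\<tau> \<ge> 0" "\<And>i j. j \<notin> J \<Longrightarrow> C$i$j = 0"
  shows "\<tau> * norm C \<le> norm (C ** transpose U)"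
  by (rule norm_ge_rows) (use assms in \<open>auto simp: row_mult_transpose bounded_below_on_def\<close>)

lemma norm_mult_ge:
  assumes "bounded_below_on J \<tau> U" "\<tau> \<ge> 0" "\<And>i j. j \<notin> J \<Longrightarrow> C$j$i = 0"
  shows "\<tau> * norm C \<le> norm (U ** C)"
  using norm_mult_transpose_ge[of J \<tau> U "transpose C"] assms
  by (metis (no_types, lifting) matrix_transpose_mul norm_transpose transpose_def vec_lambda_beta)

lemma matrix_vector_mult_restrict:
  fixes U :: "real^'k^'m"
  assumes "\<And>j. j \<notin> J \<Longrightarrow> column j U = 0"
  shows "U *v c = U *v (\<chi> j. if j \<in> J then c$j else 0)"
proof -
  have "U$i$j = 0" if "j \<notin> J" for i j
    using assms[OF that] by (simp add: column_def vec_eq_iff)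
  then show ?thesis
    by (auto simp: matrix_vector_mult_def vec_eq_iff intro!: sum.cong)
qed

text \<open>Zeroing the coefficients outside \<open>J\<close> does not change \<open>U *v c\<close>.
  For the truncated \<open>d\<close>, Cauchy-Schwarz bounds the squared norm of
  \<open>U *v d\<close> by that of \<open>transpose U *v (U *v d)\<close> times
  \<open>norm d\<close>, and \<open>norm d\<close> is controlled by \<open>U *v d\<close>
  itself.\<close>

lemma norm_gram_ge:
  fixes U :: "real^'k^'m"
  assumes U: "\<And>j. j \<notin> J \<Longrightarrow> column j U = 0" and b: "bounded_below_on J \<tau> U" and "\<tau> > 0"
  shows "\<tau> * norm (U *v c) \<le> norm (transpose U *v (U *v c))"
proof -
  define d where "d = (\<chi> j. if j \<in> J then c$j else 0)"
  have Uc: "U *v c = U *v d" unfolding d_def by (rule matrix_vector_mult_restrict) (rule U)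
  have d: "\<tau> * norm d \<le> norm (U *v d)"
    using b by (auto simp: bounded_below_on_def d_def)
  have "(norm (U *v d))\<^sup>2 = (transpose U *v (U *v d)) \<bullet> d"
    by (simp add: power2_norm_eq_inner dot_lmul_matrix)
  also have "\<dots> \<le> norm (transpose U *v (U *v d)) * norm d" by (rule norm_cauchy_schwarz)
  finally have "\<tau> * (norm (U *v d))\<^sup>2 \<le> norm (transpose U *v (U *v d)) * (\<tau> * norm d)"
    using \<open>\<tau> > 0\<close> by simp
  also have "\<dots> \<le> norm (transpose U *v (U *v d)) * norm (U *v d)"
    by (intro mult_left_mono d) simp
  finally show ?thesis unfolding Uc
    by (cases "norm (U *v d) = 0") (auto simp: power2_eq_square)
qed

lemma norm_mult_gram_ge:
  fixes U :: "real^'k^'m"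
  assumes "\<And>j. j \<notin> J \<Longrightarrow> column j U = 0" "bounded_below_on J \<tau> U" "\<tau> > 0"
  shows "\<tau> * norm (C ** transpose U) \<le> norm (C ** transpose U ** U)"
proof (rule norm_ge_rows)
  fix i
  have "(C ** transpose U ** U) $ i = transpose U *v (U *v (C $ i))"
    using row_mult_transpose[of "C ** transpose U" "transpose U" i]
    by (simp only: row_mult_transpose transpose_transpose)
  then show "\<tau> * norm ((C ** transpose U) $ i) \<le> norm ((C ** transpose U ** U) $ i)"
    using norm_gram_ge[OF assms] by (simp add: row_mult_transpose)
qed (use assms in simp)

text \<open>Orthogonal projection of \<open>b\<close> onto the range of \<open>U\<close>. The
  least-squares clause serves later to bound a residual by inserting an explicit
  \<open>y\<close>.\<close>

lemma range_decomposition: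
  fixes U :: "real^'k^'m"
  assumes U: "\<And>j. j \<notin> J \<Longrightarrow> column j U = 0"
  obtains c n where "b = U *v c + n" "\<And>j. j \<notin> J \<Longrightarrow> c$j = 0" "\<And>y. n \<bullet> (U *v y) = 0"
    "\<And>y. norm n \<le> norm (b - U *v y)"
proof -
  obtain z n where z: "z \<in> span (range ((*v) U))" and n: "\<And>w. w \<in> span (range ((*v) U)) \<Longrightarrow> orthogonal n w"
    and b: "b = z + n" using orthogonal_subspace_decomp_exists by blast
  have "span (range ((*v) U)) = range ((*v) U)"
    by (simp add: linear_subspace_image span_eq_iff)
  with z obtain c where c: "z = U *v c" by auto
  have ort: "n \<bullet> (U *v y) = 0" for y
    using n[of "U *v y"] by (auto simp: orthogonal_def span_base)
  have le: "norm n \<le> norm (b - U *v y)" for y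
  proof -
    have "n \<bullet> (b - U *v y) = (norm n)\<^sup>2"
      by (simp add: b c inner_diff_right inner_add_right ort power2_norm_eq_inner)
    then have "norm n * norm n \<le> norm n * norm (b - U *v y)"
      using norm_cauchy_schwarz[of n "b - U *v y"] by (simp add: power2_eq_square)
    then show ?thesis by (cases "norm n = 0") auto
  qed
  show thesis
    by (rule that[of "\<chi> j. if j \<in> J then c$j else 0" n])
       (use b c ort le matrix_vector_mult_restrict[OF U, where c = c] in auto)
qed

text \<open>Projects each row of \<open>B\<close> onto the range of \<open>U\<close>; orthogonality
  of all residual rows to that range becomes \<open>K ** U = 0\<close>.\<close>

lemma row_decomposition:
  fixes U :: "real^'k^'m" and B :: "real^'m^'l"
  assumes U: "\<And>j. j \<notin> J \<Longrightarrow> column j U = 0"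
  obtains S :: "real^'k^'l" and K where "B = S ** transpose U + K" "K ** U = 0"
    "\<And>i j. j \<notin> J \<Longrightarrow> S$i$j = 0" "\<And>i y. norm (K$i) \<le> norm (B$i - U *v y)"
proof -
  have "\<exists>c n. B$i = U *v c + n \<and> (\<forall>j. j \<notin> J \<longrightarrow> c$j = 0) \<and> (\<forall>y. n \<bullet> (U *v y) = 0) \<and>
    (\<forall>y. norm n \<le> norm (B$i - U *v y))" for i
    using range_decomposition[OF U, where b = "B$i"] by metis
  then obtain c n where cn: "\<And>i. B$i = U *v c i + n i" "\<And>i j. j \<notin> J \<Longrightarrow> c i$j = 0"
    "\<And>i y. n i \<bullet> (U *v y) = 0" "\<And>i y. norm (n i) \<le> norm (B$i - U *v y)"
    by metis
  show thesis
  proof (rule that[of "vec_lambda c" "vec_lambda n"])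
    show "B = vec_lambda c ** transpose U + vec_lambda n"
      using cn(1) by (simp add: vec_eq_iff[of B] row_mult_transpose)
    have "(n i v* U) = 0" for i
      using cn(3)[of i "n i v* U"] by (simp flip: dot_lmul_matrix)
    then show "vec_lambda n ** U = 0"
      using row_mult_transpose[of "vec_lambda n" "transpose U"]
      by (subst vec_eq_iff) simp
  qed (use cn in auto)
qed

lemma column_eq_0_iff: "column j (U::real^'k^'m) = 0 \<longleftrightarrow> (\<forall>i. U$i$j = 0)"
  by (simp add: column_def vec_eq_iff)

text \<open>
  With \<open>V0 = V R\<^sup>T + N\<^sup>T\<close> and \<open>U0 = U S\<^sup>T + K\<^sup>T\<close> split along the ranges of \<open>V\<close> and \<open>U\<close>, the rows of
  \<open>H = C V\<^sup>T - P\<close>, \<open>P = U0 N\<close>, decompose orthogonally. The part \<open>C V\<^sup>T\<close> is seen by \<open>H V\<close>, and \<open>P\<close> is seen by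
  \<open>H\<^sup>T U\<close> up to \<open>K\<^sup>T N\<close>, which is at most \<open>\<parallel>P\<parallel> / 4\<close> by closeness of \<open>U\<close> and \<open>U0\<close>.
\<close>

lemma factor_error_bound:
  fixes U U0 :: "real^'k^'m" and V V0 :: "real^'k^'n"
  assumes U: "\<And>j. j \<notin> J \<Longrightarrow> column j U = 0" and V: "\<And>j. j \<notin> J \<Longrightarrow> column j V = 0"
    and V0: "\<And>j. j \<notin> J \<Longrightarrow> column j V0 = 0"
    and bU: "bounded_below_on J \<tau> U" and bV: "bounded_below_on J \<tau> V" and "\<tau> > 0"
    and bU0: "bounded_below_on J s U0" and "s > 0" and close: "norm (U - U0) \<le> s / 4"
  defines "H \<equiv> U ** transpose V - U0 ** transpose V0"
  shows "\<tau> * norm H \<le> 5 / 3 * (norm (H ** V) + norm (transpose H ** U))"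
proof -
  obtain R N where RN: "transpose V0 = R ** transpose V + N" "N ** V = 0"
      "\<And>i y. norm (N$i) \<le> norm (transpose V0 $ i - V *v y)"
    by (rule row_decomposition[OF V, where B = "transpose V0"]) blast+
  obtain S K where SK: "transpose U0 = S ** transpose U + K" "K ** U = 0"
      "\<And>i j. j \<notin> J \<Longrightarrow> S$i$j = 0"
      "\<And>i y. norm (K$i) \<le> norm (transpose U0 $ i - U *v y)"
    by (rule row_decomposition[OF U, where B = "transpose U0"]) blast+
  define C where "C = U - U0 ** R"
  define P where "P = U0 ** N"
  have H: "H = C ** transpose V - P"
    by (simp add: H_def C_def P_def RN(1) matrix_mult.add_right matrix_mult.diff_left
        matrix_mul_assoc algebra_simps)
  have "U0 = transpose (S ** transpose U + K)" by (metis SK(1) transpose_transpose)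
  then have U0: "U0 = U ** transpose S + transpose K"
    by (simp add: transpose_add matrix_transpose_mul)
  have CV: "(C ** transpose V) \<bullet> (X ** N) = 0" for X
    by (simp add: inner_matrix_mult_right matrix_mul_assoc[symmetric] RN(2))
  \<comment> \<open>The competitor \<open>y = 0\<close> suffices: row \<open>j\<close> of
    \<open>transpose V0\<close> vanishes, hence its residual does too.\<close>
  have N0: "N$j = 0" if "j \<notin> J" for j
  proof -
    have "transpose V0 $ j = 0"
      using V0[OF that] by (simp add: transpose_def column_def vec_eq_iff)
    then show ?thesis using RN(3)[of j 0] by simp
  qed
  have normN: "s * norm N \<le> norm P" unfolding P_def
    by (rule norm_mult_ge[OF bU0]) (use N0 \<open>s > 0\<close> in auto)
  \<comment> \<open>The competitor is column \<open>i\<close> of \<open>U\<close>, so the residual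
    is no longer than column \<open>i\<close> of \<open>U - U0\<close>.\<close>
  have "norm (K$i) \<le> 1 * norm (transpose (U - U0) $ i)" for i
  proof -
    have "transpose U0 $ i - U *v axis i 1 = - (transpose (U - U0) $ i)"
      by (simp add: matrix_vector_mult_basis transpose_def vec_eq_iff column_def)
    then show ?thesis using SK(4)[of i "axis i 1"] by simp
  qed
  from norm_le_rows[OF this] have "norm K \<le> s / 4" using close by (simp add: norm_transpose)
  then have "norm K * norm N \<le> s / 4 * norm N" by (rule mult_right_mono) simp
  moreover have "norm (transpose K ** N) \<le> norm K * norm N"
    using norm_matrix_mult_le[of "transpose K" N] by (simp add: norm_transpose)
  ultimately have KN: "norm (transpose K ** N) \<le> norm P / 4" using normN by simp
  define Q where "Q = transpose S ** N"
  have PQ: "P = U ** Q + transpose K ** N"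
    by (simp add: P_def Q_def U0 matrix_mult.add_left matrix_mul_assoc)
  have "\<tau> * norm Q \<le> norm (U ** Q)"
  proof (rule norm_mult_ge[OF bU])
    show "Q $ j $ i = 0" if "j \<notin> J" for i j
      using SK(3)[OF that] by (simp add: Q_def matrix_matrix_mult_def transpose_def)
  qed (use \<open>\<tau> > 0\<close> in simp)
  also have "norm (U ** Q) \<le> norm P + norm (transpose K ** N)"
    using norm_triangle_ineq4[of P "transpose K ** N"] by (simp add: PQ)
  also have "\<dots> \<le> 5 / 4 * norm P" using KN by simp
  finally have normQ: "\<tau> * norm Q \<le> 5 / 4 * norm P" .
  \<comment> \<open>Since \<open>C ** transpose V\<close> is orthogonal to \<open>P\<close>, testing
    \<open>H\<close> against \<open>P\<close> isolates the norm of \<open>P\<close>; splitting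
    \<open>P\<close> by \<open>PQ\<close> then brings in \<open>transpose H ** U\<close>.\<close>
  have "(norm P)\<^sup>2 = - (H \<bullet> P)"
    by (simp add: H inner_diff_left CV[of U0, folded P_def] power2_norm_eq_inner)
  also have "\<dots> = - (H \<bullet> (U ** Q)) - H \<bullet> (transpose K ** N)"
    by (subst PQ) (simp add: inner_add_right)
  also have "H \<bullet> (transpose K ** N) = - (P \<bullet> (transpose K ** N))"
    by (simp add: H inner_diff_left CV)
  also have "H \<bullet> (U ** Q) = transpose (transpose H ** U) \<bullet> Q"
    using inner_matrix_mult_left[of U Q H] by (simp add: matrix_transpose_mul inner_commute)
  finally have "(norm P)\<^sup>2 = P \<bullet> (transpose K ** N) - transpose (transpose H ** U) \<bullet> Q" by simp
  moreover have "P \<bullet> (transpose K ** N) \<le> norm P * (norm P / 4)"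
    by (rule order_trans[OF norm_cauchy_schwarz]) (intro mult_left_mono KN, simp)
  moreover have "- (transpose (transpose H ** U) \<bullet> Q) \<le> norm (transpose H ** U) * norm Q"
    using Cauchy_Schwarz_ineq2[of "transpose (transpose H ** U)" Q] by (simp add: norm_transpose)
  \<comment> \<open>The 3/4 is what remains after absorbing the quarter from \<open>KN\<close>.
    Together with the 5/4 of \<open>normQ\<close> it produces the constant 5/3.\<close>
  ultimately have "3 / 4 * (norm P)\<^sup>2 \<le> norm (transpose H ** U) * norm Q"
    by (simp add: power2_eq_square)
  then have "\<tau> * (3 / 4 * (norm P)\<^sup>2) \<le> norm (transpose H ** U) * (\<tau> * norm Q)"
    using \<open>\<tau> > 0\<close> by simp
  also have "\<dots> \<le> norm (transpose H ** U) * (5 / 4 * norm P)"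
    by (intro mult_left_mono normQ) simp
  finally have normP: "\<tau> * norm P \<le> 5 / 3 * norm (transpose H ** U)"
    by (cases "norm P = 0") (auto simp: power2_eq_square)
  have "H ** V = C ** transpose V ** V"
    by (simp add: H P_def matrix_mult.diff_left matrix_mul_assoc[symmetric] RN(2))
  then have "\<tau> * norm (C ** transpose V) \<le> norm (H ** V)"
    using norm_mult_gram_ge[OF V bV \<open>\<tau> > 0\<close>] by simp
  moreover have "\<tau> * norm H \<le> \<tau> * (norm (C ** transpose V) + norm P)"
    unfolding H using norm_triangle_ineq4 \<open>\<tau> > 0\<close> by (intro mult_left_mono) auto
  ultimately show ?thesis
    using normP norm_ge_zero[of "H ** V"] unfolding distrib_left by linarith
qed

section \<open>Singular value decompositions\<close>

text \<open>A minimizer \<open>x\<close> of the quadratic form on the unit sphere of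
  \<open>S\<close> exists by compactness. The form \<open>q\<close> is nonnegative on
  \<open>S\<close> and vanishes at \<open>x\<close>; a nonzero residual
  \<open>w = D x - l *\<^sub>R x\<close> would be a direction along which \<open>q\<close> becomes
  negative.\<close>

lemma self_adjoint_min_eigenvector:
  fixes D :: "'a::euclidean_space \<Rightarrow> 'a"
  assumes lin: "linear D" and sa: "\<And>x y. D x \<bullet> y = x \<bullet> D y"
    and S: "subspace S" and inv: "\<And>x. x \<in> S \<Longrightarrow> D x \<in> S" and "S \<noteq> {0}"
  obtains x l where "x \<in> S" "norm x = 1" "D x = l *\<^sub>R x" "\<And>y. y \<in> S \<Longrightarrow> l * (norm y)\<^sup>2 \<le> D y \<bullet> y"
proof -
  obtain z where z: "z \<in> S" "z \<noteq> 0" using S \<open>S \<noteq> {0}\<close> subspace_0 by blast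
  then have "z /\<^sub>R norm z \<in> sphere 0 1 \<inter> S" using S by (simp add: subspace_scale)
  moreover have "compact (sphere 0 1 \<inter> S)"
    by (intro compact_Int_closed closed_subspace S) simp
  moreover have "continuous_on (sphere 0 1 \<inter> S) (\<lambda>x. D x \<bullet> x)"
    by (intro continuous_intros linear_continuous_on linear_conv_bounded_linear[THEN iffD1] lin)
  ultimately obtain x where x: "x \<in> S" "norm x = 1"
    and min: "\<And>y. y \<in> S \<Longrightarrow> norm y = 1 \<Longrightarrow> D x \<bullet> x \<le> D y \<bullet> y"
    using continuous_attains_inf[of "sphere 0 1 \<inter> S" "\<lambda>x. D x \<bullet> x"] by fastforce
  define l where "l = D x \<bullet> x"
  define q where "q y = D y \<bullet> y - l * (norm y)\<^sup>2" for y
  have q: "q y \<ge> 0" if "y \<in> S" for y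
  proof (cases "y = 0")
    case False
    have "l \<le> D (y /\<^sub>R norm y) \<bullet> (y /\<^sub>R norm y)"
      unfolding l_def by (rule min) (use that S False in \<open>auto simp: subspace_scale\<close>)
    then show ?thesis
      using False by (simp add: q_def linear_scale[OF lin] divide_simps power2_eq_square split: if_splits)
  qed (simp add: q_def)
  define w where "w = D x - l *\<^sub>R x"
  have w: "w \<in> S" unfolding w_def by (intro subspace_diff subspace_scale inv x S)
  have exp: "q (x + t *\<^sub>R w) = 2 * t * (norm w)\<^sup>2 + t\<^sup>2 * q w" for t
  proof -
    have "(norm w)\<^sup>2 = w \<bullet> (D x - l *\<^sub>R x)"
      by (simp add: power2_norm_eq_inner flip: w_def)
    then have nw: "(norm w)\<^sup>2 = w \<bullet> D x - l * (w \<bullet> x)" by (simp add: inner_diff_right)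
    have nx: "(norm (x + t *\<^sub>R w))\<^sup>2 = 1 + 2 * t * (w \<bullet> x) + t\<^sup>2 * (norm w)\<^sup>2"
      using x(2) unfolding power2_norm_eq_inner
      by (simp add: inner_add_left inner_add_right inner_commute power2_eq_square norm_eq_1 algebra_simps)
    have Dx: "D (x + t *\<^sub>R w) \<bullet> (x + t *\<^sub>R w) = l + 2 * t * (w \<bullet> D x) + t\<^sup>2 * (D w \<bullet> w)"
      using sa[of w x] by (simp add: l_def linear_add[OF lin] linear_scale[OF lin] inner_add_left
          inner_add_right inner_commute power2_eq_square algebra_simps)
    show ?thesis
      unfolding q_def nx Dx by (simp add: nw algebra_simps)
  qed
  have "w = 0"
  proof (rule ccontr)
    assume "w \<noteq> 0"
    define a b where "a = (norm w)\<^sup>2" and "b = q w"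
    have ab: "a > 0" "b \<ge> 0" using \<open>w \<noteq> 0\<close> q[OF w] by (auto simp: a_def b_def)
    \<comment> \<open>The step along \<open>w\<close> is \<open>- a / c\<close>. Adding 1 keeps the
      denominator positive even if \<open>b = 0\<close>.\<close>
    define c where "c = b + 1"
    have c: "c > 0" "b = c - 1" using ab by (auto simp: c_def)
    have "0 \<le> q (x + (- a / c) *\<^sub>R w)"
      by (intro q subspace_add subspace_scale x w S)
    also have "\<dots> = - (a\<^sup>2 * (c + 1)) / c\<^sup>2"
      unfolding exp a_def[symmetric] b_def[symmetric] c(2) using c(1)
      by (simp add: field_simps power2_eq_square)
    also have "\<dots> < 0" using ab c by (simp add: divide_neg_pos)
    finally show False by simp
  qed
  then show thesis
    using q by (intro that[OF x(1,2), of l]) (auto simp: w_def q_def)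
qed

section \<open>Orthonormal families and Bessel's inequality\<close>

definition orthonormal :: "'i set \<Rightarrow> ('i \<Rightarrow> 'a::real_inner) \<Rightarrow> bool" where
  "orthonormal I u \<longleftrightarrow> finite I \<and> (\<forall>i\<in>I. \<forall>j\<in>I. u i \<bullet> u j = (if i = j then 1 else 0))"

lemma orthonormal_subset: "orthonormal I u \<Longrightarrow> I' \<subseteq> I \<Longrightarrow> orthonormal I' u"
  unfolding orthonormal_def by (meson finite_subset subsetD)

lemma orthonormal_inner_sum:
  "orthonormal I u \<Longrightarrow> j \<in> I \<Longrightarrow> (\<Sum>i\<in>I. c i *\<^sub>R u i) \<bullet> u j = c j"
  by (simp add: orthonormal_def inner_sum_left if_distrib[of "(*) _"] cong: if_cong)

lemma orthonormal_norm_sum: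
  assumes "orthonormal I u"
  shows "(norm (\<Sum>i\<in>I. c i *\<^sub>R u i))\<^sup>2 = (\<Sum>i\<in>I. (c i)\<^sup>2)"
  unfolding power2_norm_eq_inner
  by (subst inner_sum_right)
     (simp add: orthonormal_inner_sum[OF assms] power2_eq_square)

text \<open>Completing the square: the two sides differ by the sum of the squares of
  \<open>c i - u i \<bullet> x\<close>. It bounds from below the distance of \<open>x\<close> to a
  subspace with orthonormal basis \<open>u\<close>.\<close>

lemma orthonormal_dist_span:
  assumes u: "orthonormal I u"
  shows "(norm x)\<^sup>2 - (\<Sum>i\<in>I. (u i \<bullet> x)\<^sup>2) \<le> (norm ((\<Sum>i\<in>I. c i *\<^sub>R u i) - x))\<^sup>2"
proof -
  have "(norm ((\<Sum>i\<in>I. c i *\<^sub>R u i) - x))\<^sup>2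
      = (norm (\<Sum>i\<in>I. c i *\<^sub>R u i))\<^sup>2 - 2 * ((\<Sum>i\<in>I. c i *\<^sub>R u i) \<bullet> x) + (norm x)\<^sup>2"
    unfolding power2_norm_eq_inner by (simp add: inner_diff_left inner_diff_right inner_commute)
  also have "\<dots> = (\<Sum>i\<in>I. (c i)\<^sup>2) - 2 * (\<Sum>i\<in>I. c i * (u i \<bullet> x)) + (norm x)\<^sup>2"
    by (simp add: orthonormal_norm_sum[OF u] inner_sum_left)
  also have "\<dots> = (\<Sum>i\<in>I. (c i - u i \<bullet> x)\<^sup>2) - (\<Sum>i\<in>I. (u i \<bullet> x)\<^sup>2) + (norm x)\<^sup>2"
    by (simp add: power2_diff sum.distrib sum_subtractf sum_distrib_left mult_ac)
  also have "\<dots> \<ge> - (\<Sum>i\<in>I. (u i \<bullet> x)\<^sup>2) + (norm x)\<^sup>2"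
    by (simp add: sum_nonneg)
  finally show ?thesis by simp
qed

lemma bessel_inequality:
  assumes "orthonormal I u" shows "(\<Sum>i\<in>I. (u i \<bullet> x)\<^sup>2) \<le> (norm x)\<^sup>2"
proof -
  let ?p = "\<Sum>i\<in>I. (u i \<bullet> x) *\<^sub>R u i"
  have "?p \<bullet> x = (\<Sum>i\<in>I. (u i \<bullet> x)\<^sup>2)" by (simp add: inner_sum_left power2_eq_square)
  moreover have "(norm (x - ?p))\<^sup>2 = (norm x)\<^sup>2 - 2 * (?p \<bullet> x) + (norm ?p)\<^sup>2"
    unfolding power2_norm_eq_inner by (simp add: inner_diff_left inner_diff_right inner_commute)
  ultimately have "(norm (x - ?p))\<^sup>2 = (norm x)\<^sup>2 - (\<Sum>i\<in>I. (u i \<bullet> x)\<^sup>2)"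
    using orthonormal_norm_sum[OF assms, of "\<lambda>i. u i \<bullet> x"] by simp
  then show ?thesis using zero_le_power2[of "norm (x - ?p)"] by linarith
qed

lemma dim_span_orthonormal:
  fixes u :: "'i \<Rightarrow> 'a::euclidean_space"
  assumes u: "orthonormal I u"
  shows "dim (span (u ` I)) = card I"
proof -
  have inj: "inj_on u I"
    using u by (auto simp: orthonormal_def inj_on_def) (metis zero_neq_one)
  have "pairwise orthogonal (u ` I)"
    using u by (auto simp: orthonormal_def pairwise_def orthogonal_def)
  moreover have "0 \<notin> u ` I" using u by (force simp: orthonormal_def)
  ultimately have "independent (u ` I)" by (rule pairwise_orthogonal_independent)
  then have "dim (span (u ` I)) = card (u ` I)" by (simp add: dim_eq_card_independent)
  also have "\<dots> = card I" by (rule card_image[OF inj])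
  finally show ?thesis .
qed

definition rank_one_sum :: "'i set \<Rightarrow> ('i \<Rightarrow> real) \<Rightarrow> ('i \<Rightarrow> real^'m) \<Rightarrow> ('i \<Rightarrow> real^'n) \<Rightarrow> real^'n^'m" where
  "rank_one_sum I \<sigma> u v = (\<Sum>i\<in>I. \<sigma> i *\<^sub>R (\<chi> a b. u i $ a * v i $ b))"

lemma rank_one_sum_mult:
  "rank_one_sum I \<sigma> u v *v x = (\<Sum>i\<in>I. (\<sigma> i * (v i \<bullet> x)) *\<^sub>R u i)"
  unfolding rank_one_sum_def
  by (simp add: vec_eq_iff matrix_vector_mult_def inner_vec_def sum_distrib_right sum_distrib_left mult_ac)
     (subst sum.swap, simp)

lemma transpose_rank_one_sum: "transpose (rank_one_sum I \<sigma> u v) = rank_one_sum I \<sigma> v u"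
  by (simp add: rank_one_sum_def transpose_def vec_eq_iff mult.commute)

text \<open>The vector \<open>v i\<close> divided by \<open>\<sigma> i\<close> is mapped to
  \<open>u i\<close>. This identifies the rank with the number of summands.\<close>

lemma range_rank_one_sum:
  assumes u: "orthonormal I u" and v: "orthonormal I v" and pos: "\<And>i. i \<in> I \<Longrightarrow> \<sigma> i \<noteq> 0"
  shows "range ((*v) (rank_one_sum I \<sigma> u v)) = span (u ` I)"
proof
  show "range ((*v) (rank_one_sum I \<sigma> u v)) \<subseteq> span (u ` I)"
    unfolding rank_one_sum_mult by (intro image_subsetI span_sum span_scale span_base imageI)
  have "u i \<in> range ((*v) (rank_one_sum I \<sigma> u v))" if "i \<in> I" for i
  proof -
    have "rank_one_sum I \<sigma> u v *v ((1 / \<sigma> i) *\<^sub>R v i) = (\<Sum>j\<in>I. if j = i then u i else 0)"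
      unfolding rank_one_sum_mult
      using v that pos by (intro sum.cong) (auto simp: orthonormal_def)
    also have "\<dots> = u i" using that u by (simp add: orthonormal_def)
    finally show ?thesis by (metis rangeI)
  qed
  then show "span (u ` I) \<subseteq> range ((*v) (rank_one_sum I \<sigma> u v))"
    by (intro span_minimal linear_subspace_image) auto
qed

text \<open>Discards the zero singular values and identifies the surviving indices with
  \<open>{1..r}\<close>, which gives \<open>\<sigma> r\<close> its meaning as the smallest nonzero
  singular value.\<close>

lemma thin_svd:
  fixes M :: "real^'n^'m"
  assumes sv: "singular_values M \<sigma>" and rk: "rank M = r" and r: "r \<ge> 1"
  obtains u :: "nat \<Rightarrow> real^'m" and v :: "nat \<Rightarrow> real^'n"
  where "orthonormal {1..r} u" "orthonormal {1..r} v" "M = rank_one_sum {1..r} \<sigma> u v"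
    "\<sigma> r > 0" "\<And>i. i \<in> {1..r} \<Longrightarrow> \<sigma> r \<le> \<sigma> i" "\<And>i. i \<in> {1..r} \<Longrightarrow> \<sigma> i \<le> \<sigma> 1"
proof -
  let ?m = "CARD('m)"
  have nonneg: "0 \<le> \<sigma> i" if "i \<in> {1..?m}" for i
    using sv that unfolding singular_values_def by blast
  have mono: "\<sigma> j \<le> \<sigma> i" if "i \<in> {1..?m}" "j \<in> {1..?m}" "i \<le> j" for i j
    using sv that unfolding singular_values_def by blast
  obtain u :: "nat \<Rightarrow> real^'m" and v :: "nat \<Rightarrow> real^'n" where
    uv: "\<forall>i\<in>{1..?m}. \<forall>j\<in>{1..?m}.
           u i \<bullet> u j = (if i = j then 1 else 0) \<and> v i \<bullet> v j = (if i = j then 1 else 0)" and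
    "M = (\<Sum>i = 1..?m. \<sigma> i *\<^sub>R (\<chi> a b. u i $ a * v i $ b))"
    using sv unfolding singular_values_def by blast
  then have u: "orthonormal {1..?m} u" and v: "orthonormal {1..?m} v" and
    M: "M = rank_one_sum {1..?m} \<sigma> u v"
    by (simp_all add: orthonormal_def rank_one_sum_def)
  define I where "I = {i \<in> {1..?m}. \<sigma> i > 0}"
  have I: "I \<subseteq> {1..?m}" "finite I" by (auto simp: I_def)
  have uI: "orthonormal I u" and vI: "orthonormal I v"
    using u v I(1) orthonormal_subset by blast+
  have "M = rank_one_sum I \<sigma> u v"
    unfolding M rank_one_sum_def
  proof (rule sum.mono_neutral_right)
    show "\<forall>i\<in>{1..?m} - I. \<sigma> i *\<^sub>R (\<chi> a b. u i $ a * v i $ b) = 0"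
      using nonneg by (force simp: I_def)
  qed (use I in auto)
  have "r = card I"
    using range_rank_one_sum[OF uI vI, of \<sigma>] dim_span_orthonormal[OF uI] rk
    by (simp add: rank_dim_range \<open>M = rank_one_sum I \<sigma> u v\<close> I_def)
  then have "I \<noteq> {}" using r by auto
  then have Max: "Max I \<in> I" using I(2) by simp
  \<comment> \<open>Monotonicity makes the indices of positive singular values an initial segment;
    its length is the rank.\<close>
  have "I = {1..Max I}"
  proof
    show "I \<subseteq> {1..Max I}" using I by (auto simp: I_def)
    show "{1..Max I} \<subseteq> I"
    proof
      fix i assume "i \<in> {1..Max I}"
      moreover have "Max I \<in> {1..?m}" "\<sigma> (Max I) > 0" using Max by (auto simp: I_def)
      ultimately show "i \<in> I" using mono[of i "Max I"] by (auto simp: I_def)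
    qed
  qed
  then have Ir: "I = {1..r}" using \<open>r = card I\<close> by (metis card_atLeastAtMost diff_Suc_1)
  have rm: "r \<in> I" using Ir r by simp
  show thesis
  proof (rule that[of u v])
    show "M = rank_one_sum {1..r} \<sigma> u v" using \<open>M = rank_one_sum I \<sigma> u v\<close> Ir by simp
    show "\<sigma> r > 0" using rm by (simp add: I_def)
    show "\<sigma> r \<le> \<sigma> i" "\<sigma> i \<le> \<sigma> 1" if "i \<in> {1..r}" for i
    proof -
      have "i \<in> {1..?m}" "r \<in> {1..?m}" "1 \<in> {1..?m}"
        using that rm Ir I(1) r by auto
      then show "\<sigma> r \<le> \<sigma> i" "\<sigma> i \<le> \<sigma> 1" using that by (auto intro!: mono)
    qed
  qed (use uI vI Ir in auto)
qed

lemma rank_one_sum_norm_le: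
  assumes u: "orthonormal I u" and v: "orthonormal I v"
    and \<sigma>: "\<And>i. i \<in> I \<Longrightarrow> 0 \<le> \<sigma> i \<and> \<sigma> i \<le> c" and "c \<ge> 0"
  shows "norm (rank_one_sum I \<sigma> u v *v x) \<le> c * norm x"
proof -
  have "(norm (rank_one_sum I \<sigma> u v *v x))\<^sup>2 = (\<Sum>i\<in>I. (\<sigma> i)\<^sup>2 * (v i \<bullet> x)\<^sup>2)"
    by (simp add: rank_one_sum_mult orthonormal_norm_sum[OF u] power_mult_distrib)
  also have "\<dots> \<le> (\<Sum>i\<in>I. c\<^sup>2 * (v i \<bullet> x)\<^sup>2)"
    by (intro sum_mono mult_right_mono power_mono) (use \<sigma> in auto)
  also have "\<dots> \<le> (c * norm x)\<^sup>2"
    using bessel_inequality[OF v, of x] by (simp add: power_mult_distrib mult_left_mono flip: sum_distrib_left)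
  finally show ?thesis by (rule power2_le_imp_le) (simp add: \<open>c \<ge> 0\<close>)
qed

text \<open>A vector of the range is a combination of the \<open>u i\<close>, so Parseval's identity
  loses nothing, and the transpose scales each coefficient by at least \<open>s\<close>.\<close>

lemma rank_one_sum_transpose_norm_ge:
  assumes u: "orthonormal I u" and v: "orthonormal I v"
    and \<sigma>: "\<And>i. i \<in> I \<Longrightarrow> s \<le> \<sigma> i" and "s \<ge> 0"
    and y: "y \<in> range ((*v) (rank_one_sum I \<sigma> u v))"
  shows "s * norm y \<le> norm (transpose (rank_one_sum I \<sigma> u v) *v y)"
proof -
  obtain x where y: "y = (\<Sum>i\<in>I. (\<sigma> i * (v i \<bullet> x)) *\<^sub>R u i)"
    using y by (auto simp: rank_one_sum_mult)
  have uy: "u i \<bullet> y = \<sigma> i * (v i \<bullet> x)" if "i \<in> I" for i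
    using orthonormal_inner_sum[OF u that] by (simp add: y inner_commute)
  have "(s * norm y)\<^sup>2 = (\<Sum>i\<in>I. s\<^sup>2 * (u i \<bullet> y)\<^sup>2)"
    by (subst y) (simp add: power_mult_distrib orthonormal_norm_sum[OF u] sum_distrib_left uy)
  also have "\<dots> \<le> (\<Sum>i\<in>I. (\<sigma> i)\<^sup>2 * (u i \<bullet> y)\<^sup>2)"
    by (intro sum_mono mult_right_mono power_mono \<sigma>) (use \<open>s \<ge> 0\<close> in auto)
  also have "\<dots> = (norm (transpose (rank_one_sum I \<sigma> u v) *v y))\<^sup>2"
    unfolding transpose_rank_one_sum
    by (simp add: rank_one_sum_mult orthonormal_norm_sum[OF v] power_mult_distrib)
  finally show ?thesis by (rule power2_le_imp_le) simp
qed

section \<open>Balanced factors and restricted eigenvalues\<close>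

lemma norm_mult_gram_cong:
  fixes U :: "real^'k^'m" and V :: "real^'k^'n"
  assumes "transpose U ** U = transpose V ** V"
  shows "norm (U *v x) = norm (V *v x)"
proof -
  have "(U *v x) \<bullet> (U *v x) = (transpose U ** U *v x) \<bullet> x" for U :: "real^'k^'l"
    by (simp add: dot_lmul_matrix flip: matrix_vector_mul_assoc)
  from this[of U] this[of V] show ?thesis
    by (simp add: assms norm_eq_sqrt_inner)
qed

lemma column_eq_mult_axis: "column j (U::real^'k^'m) = U *v axis j 1"
  by (simp add: matrix_vector_mult_basis)

text \<open>
  An eigenvector \<open>e\<close> of \<open>D = V\<^sup>T V = U\<^sup>T U\<close> with eigenvalue \<open>l\<close> satisfies \<open>M (V e) = l U e\<close>,
  \<open>M\<^sup>T (U e) = l V e\<close> and \<open>\<parallel>U e\<parallel> = \<parallel>V e\<parallel>\<close>, so bounds on the singular values of \<open>M\<close> carry over to \<open>l\<close>.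
\<close>

lemma factor_spectrum:
  fixes U :: "real^'k^'m" and V :: "real^'k^'n" and u :: "nat \<Rightarrow> real^'m" and v :: "nat \<Rightarrow> real^'n"
  assumes u: "orthonormal {1..r} u" and v: "orthonormal {1..r} v" and r: "r \<ge> 1"
    and UV: "U ** transpose V = rank_one_sum {1..r} \<sigma> u v"
    and pos: "s > 0" and \<sigma>: "\<And>i. i \<in> {1..r} \<Longrightarrow> s \<le> \<sigma> i" "\<And>i. i \<in> {1..r} \<Longrightarrow> \<sigma> i \<le> t"
    and gram: "transpose U ** U = transpose V ** V" and cols: "nonzero_columns U = r"
  defines "J \<equiv> colsupp U"
  shows "bounded_below_on J (sqrt s) U" "bounded_below_on J (sqrt s) V"
    "norm (U *v x) \<le> sqrt t * norm x" "norm (V *v x) \<le> sqrt t * norm x"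
    "\<And>j. j \<notin> J \<longleftrightarrow> column j V = 0"
proof -
  let ?M = "rank_one_sum {1..r} \<sigma> u v"
  define D where "D = transpose V ** V"
  have nUV: "norm (U *v x) = norm (V *v x)" for x by (rule norm_mult_gram_cong[OF gram])
  have J: "j \<notin> J \<longleftrightarrow> column j V = 0" for j
    using nUV[of "axis j 1"] unfolding J_def colsupp_def mem_Collect_eq not_not column_eq_mult_axis
    by (metis norm_eq_zero)
  then show "\<And>j. j \<notin> J \<longleftrightarrow> column j V = 0" .
  have cardJ: "card J = r" using cols by (simp add: nonzero_columns_colsupp J_def)
  have linD: "linear ((*v) D)" by simp
  have DV: "(D *v x) \<bullet> y = (V *v x) \<bullet> (V *v y)" for x y
    unfolding D_def by (simp add: dot_lmul_matrix flip: matrix_vector_mul_assoc)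
  have saD: "(D *v x) \<bullet> y = x \<bullet> (D *v y)" for x y
    using DV[of x y] DV[of y x] by (simp add: inner_commute)
  have Dnorm: "(D *v x) \<bullet> x = (norm (V *v x))\<^sup>2" for x
    by (simp add: DV power2_norm_eq_inner)
  \<comment> \<open>The factorization gives one inclusion; the dimensions agree because
    \<open>U\<close> has only \<open>r\<close> nonzero columns.\<close>
  have "range ((*v) U) = range ((*v) ?M)"
  proof -
    have "range ((*v) ?M) \<subseteq> range ((*v) U)"
      unfolding UV[symmetric] by (metis image_subsetI matrix_vector_mul_assoc rangeI)
    moreover have "dim (range ((*v) U)) \<le> dim (range ((*v) ?M))"
    proof -
      have "dim (range ((*v) ?M)) = r"
        using range_rank_one_sum[OF u v, of \<sigma>] \<sigma>(1) pos dim_span_orthonormal[OF u] by fastforce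
      then show ?thesis
        using rank_le_nonzero_columns[of U] cols by (simp add: rank_dim_range)
    qed
    ultimately show ?thesis
      by (metis linear_subspace_image matrix_vector_mul_linear subspace_UNIV subspace_dim_equal)
  qed
  have rankU: "rank U = r"
    using range_rank_one_sum[OF u v, of \<sigma>] \<sigma>(1) pos dim_span_orthonormal[OF u]
      \<open>range ((*v) U) = range ((*v) ?M)\<close> by (fastforce simp: rank_dim_range)
  have t: "t \<ge> 0" using \<sigma>[of 1] r pos by fastforce

  have up: "norm (V *v x) \<le> sqrt t * norm x" for x
  proof -
    \<comment> \<open>The largest eigenvalue of \<open>D\<close> is obtained by minimizing for the
      negative of \<open>D\<close> over the whole space.\<close>
    obtain e l where e: "norm e = 1" "- (D *v e) = l *\<^sub>R e"
      and l: "\<And>y. l * (norm y)\<^sup>2 \<le> - (D *v y) \<bullet> y"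
    proof (rule self_adjoint_min_eigenvector[where D="\<lambda>x. - (D *v x)" and S=UNIV])
      show "linear (\<lambda>x. - (D *v x))" using linear_compose_neg[OF linD] .
      have "axis undefined 1 \<noteq> (0::real^'k)" by (simp add: axis_eq_0_iff)
      then show "(UNIV :: (real^'k) set) \<noteq> {0}" by blast
    qed (use saD in auto)
    define L where "L = - l"
    have De: "D *v e = L *\<^sub>R e"
      using e(2) unfolding L_def by (metis minus_equation_iff scaleR_minus_left)
    have L: "L = (norm (V *v e))\<^sup>2"
      using Dnorm[of e] e(1) unfolding De by (simp add: norm_eq_1)
    then have "L \<ge> 0" by simp
    have "?M *v (V *v e) = U *v (D *v e)"
      unfolding UV[symmetric] D_def by (simp only: matrix_mul_assoc matrix_vector_mul_assoc)
    then have "L * norm (U *v e) = norm (?M *v (V *v e))"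
      using \<open>L \<ge> 0\<close> by (simp add: De matrix_vector_mult_scaleR)
    also have "\<dots> \<le> t * norm (V *v e)"
      by (rule rank_one_sum_norm_le[OF u v]) (use \<sigma> pos t in force)+
    finally have "L \<le> t"
      using nUV[of e] L t by (cases "norm (V *v e) = 0") auto
    have "(norm (V *v x))\<^sup>2 \<le> L * (norm x)\<^sup>2" using l[of x] Dnorm[of x] by (simp add: L_def)
    also have "\<dots> \<le> t * (norm x)\<^sup>2" by (rule mult_right_mono) (use \<open>L \<le> t\<close> in auto)
    also have "\<dots> = (sqrt t * norm x)\<^sup>2" using t by (simp add: power_mult_distrib)
    finally show ?thesis by (rule power2_le_imp_le) (use t in auto)
  qed
  then show "norm (V *v x) \<le> sqrt t * norm x" "norm (U *v x) \<le> sqrt t * norm x"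
    by (simp_all add: nUV)

  define S where "S = {c::real^'k. \<forall>j. j \<notin> J \<longrightarrow> c$j = 0}"
  \<comment> \<open>The columns indexed by \<open>J\<close> are \<open>r\<close> in number and span
    a space of dimension \<open>r\<close>. A vanishing combination with nonzero entry
    \<open>i\<close> would express column \<open>i\<close> through the other \<open>r - 1\<close>,
    which is too few.\<close>
  have inj: "U *v c \<noteq> 0" if c: "c \<in> S" "c \<noteq> 0" for c
  proof
    assume 0: "U *v c = 0"
    obtain i where i: "c$i \<noteq> 0" using c(2) by (auto simp: vec_eq_iff)
    then have "i \<in> J" using c(1) by (auto simp: S_def)
    let ?T = "(\<lambda>j. column j U) ` (J - {i})"
    have "0 = (\<Sum>j\<in>UNIV. c$j *\<^sub>R column j U)"
      using 0 by (simp add: matrix_mult_sum scalar_mult_eq_scaleR)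
    also have "\<dots> = c$i *\<^sub>R column i U + (\<Sum>j\<in>UNIV-{i}. c$j *\<^sub>R column j U)"
      by (simp add: sum.remove[of _ i])
    also have "(\<Sum>j\<in>UNIV-{i}. c$j *\<^sub>R column j U) = (\<Sum>j\<in>J-{i}. c$j *\<^sub>R column j U)"
      by (rule sum.mono_neutral_right) (use c(1) in \<open>auto simp: S_def\<close>)
    finally have "c$i *\<^sub>R column i U = - (\<Sum>j\<in>J-{i}. c$j *\<^sub>R column j U)"
      by (simp add: eq_neg_iff_add_eq_0)
    also have "\<dots> \<in> span ?T"
      by (intro span_neg span_sum span_scale span_base imageI)
    finally have "(1 / c$i) *\<^sub>R c$i *\<^sub>R column i U \<in> span ?T" by (rule span_scale)
    then have i_span: "column i U \<in> span ?T" using i by simp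
    have "columns U \<subseteq> span ?T"
    proof
      fix x assume "x \<in> columns U"
      then obtain j where j: "x = column j U" by (auto simp: columns_def)
      consider "j = i" | "j \<in> J - {i}" | "j \<notin> J" by auto
      then show "x \<in> span ?T"
        using i_span by cases (auto simp: j J_def colsupp_def intro: span_base span_zero)
    qed
    then have "dim (columns U) \<le> card ?T" by (rule dim_le_card) simp
    also have "\<dots> \<le> card (J - {i})" by (rule card_image_le) simp
    also have "\<dots> < r" using \<open>i \<in> J\<close> cardJ r by simp
    finally show False using rankU by (simp add: column_rank_def)
  qed
  have low: "bounded_below_on J (sqrt s) V"
  proof -
    \<comment> \<open>Here the minimum is over the coordinate subspace \<open>S\<close>, since any
      zero column would give the eigenvalue 0. \<open>S\<close> is invariant because entry
      \<open>j\<close> of \<open>D *v x\<close> is an inner product with column \<open>j\<close> of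
      \<open>V\<close>.\<close>
    obtain e l where e: "e \<in> S" "norm e = 1" "D *v e = l *\<^sub>R e"
      and l: "\<And>y. y \<in> S \<Longrightarrow> l * (norm y)\<^sup>2 \<le> (D *v y) \<bullet> y"
    proof (rule self_adjoint_min_eigenvector[where D="(*v) D" and S=S])
      show "subspace S" by (auto simp: S_def subspace_def)
      show "D *v x \<in> S" if "x \<in> S" for x
      proof -
        have "(D *v x) $ j = 0" if "j \<notin> J" for j
          using DV[of x "axis j 1"] J[of j] that
          by (simp add: inner_axis flip: column_eq_mult_axis)
        then show ?thesis by (simp add: S_def)
      qed
      obtain j where "j \<in> J" using cardJ r by fastforce
      then have "axis j 1 \<in> S" by (auto simp: S_def axis_def)
      moreover have "axis j 1 \<noteq> (0::real^'k)" by (simp add: axis_eq_0_iff)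
      ultimately show "S \<noteq> {0}" by blast
    qed (use linD saD in auto)
    have Ue: "norm (U *v e) > 0" using inj[of e] e(1,2) by fastforce
    have ll: "l = (norm (V *v e))\<^sup>2"
      using Dnorm[of e] e(2) unfolding e(3) by (simp add: norm_eq_1)
    have "transpose ?M *v (U *v e) = V *v (D *v e)"
      unfolding UV[symmetric] D_def gram[symmetric]
      by (simp only: matrix_transpose_mul transpose_transpose matrix_vector_mul_assoc matrix_mul_assoc)
    then have "s * norm (U *v e) \<le> norm (l *\<^sub>R (V *v e))"
      using rank_one_sum_transpose_norm_ge[OF u v, of s \<sigma> "U *v e"] \<sigma>(1) pos
        \<open>range ((*v) U) = range ((*v) ?M)\<close>
      by (fastforce simp: e(3) matrix_vector_mult_scaleR)
    then have "s * norm (U *v e) \<le> l * norm (U *v e)" using ll by (simp add: nUV)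
    then have "s \<le> l" using Ue by simp
    have "sqrt s * norm y \<le> norm (V *v y)" if "y \<in> S" for y
    proof (rule power2_le_imp_le)
      have "(sqrt s * norm y)\<^sup>2 = s * (norm y)\<^sup>2" using pos by (simp add: power_mult_distrib)
      also have "\<dots> \<le> l * (norm y)\<^sup>2" by (rule mult_right_mono) (use \<open>s \<le> l\<close> in auto)
      also have "\<dots> \<le> (norm (V *v y))\<^sup>2" using l[OF that] by (simp add: Dnorm)
      finally show "(sqrt s * norm y)\<^sup>2 \<le> (norm (V *v y))\<^sup>2" .
    qed simp
    then show ?thesis by (simp add: bounded_below_on_def S_def)
  qed
  then show "bounded_below_on J (sqrt s) V" "bounded_below_on J (sqrt s) U"
    by (simp_all add: bounded_below_on_def nUV)
qed

text \<open>An Eckart-Young type bound. Each \<open>X *v v i\<close> lies in the range of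
  \<open>X\<close>, so its distance to \<open>\<sigma> i *\<^sub>R u i\<close> is at least that of
  the latter to this range. Bessel's inequality for \<open>u\<close> bounds the total projection
  onto the range by \<open>rank X\<close>; Bessel for \<open>v\<close>, applied to the rows of the
  difference, returns to the Frobenius norm.\<close>

lemma rank_approximation_lower_bound:
  fixes X :: "real^'n^'m" and u :: "nat \<Rightarrow> real^'m" and v :: "nat \<Rightarrow> real^'n"
  assumes u: "orthonormal I u" and v: "orthonormal I v"
    and "s \<ge> 0" and \<sigma>: "\<And>i. i \<in> I \<Longrightarrow> s \<le> \<sigma> i"
  shows "s\<^sup>2 * (real (card I) - real (rank X)) \<le> (norm (X - rank_one_sum I \<sigma> u v))\<^sup>2"
proof -
  let ?M = "rank_one_sum I \<sigma> u v"
  have "subspace (range ((*v) X))" by (simp add: linear_subspace_image)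
  then obtain B where B: "B \<subseteq> range ((*v) X)" "pairwise orthogonal B" "\<And>x. x \<in> B \<Longrightarrow> norm x = 1"
    "independent B" "card B = dim (range ((*v) X))" "span B = range ((*v) X)"
    using orthonormal_basis_subspace by metis
  have "finite B" using B(4) by (rule independent_imp_finite)
  then have oB: "orthonormal B (\<lambda>b. b)"
    using B(2,3) by (auto simp: orthonormal_def pairwise_def orthogonal_def norm_eq_1)
  have nu: "norm (u i) = 1" if "i \<in> I" for i using u that by (simp add: orthonormal_def norm_eq_1)
  have each: "s\<^sup>2 * (1 - (\<Sum>b\<in>B. (b \<bullet> u i)\<^sup>2)) \<le> (norm ((X - ?M) *v v i))\<^sup>2" if i: "i \<in> I" for i
  proof -
    have "?M *v v i = (\<Sum>j\<in>I. if j = i then \<sigma> i *\<^sub>R u i else 0)"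
      unfolding rank_one_sum_mult using v i by (intro sum.cong) (auto simp: orthonormal_def)
    also have "\<dots> = \<sigma> i *\<^sub>R u i" using u i by (simp add: orthonormal_def)
    finally have Mv: "?M *v v i = \<sigma> i *\<^sub>R u i" .
    have "X *v v i \<in> span B" using B(6) by simp
    then obtain c where c: "X *v v i = (\<Sum>b\<in>B. c b *\<^sub>R b)"
      using span_finite[OF \<open>finite B\<close>] by auto
    have "(\<Sum>b\<in>B. (b \<bullet> u i)\<^sup>2) \<le> 1" using bessel_inequality[OF oB, of "u i"] nu[OF i] by simp
    then have "s\<^sup>2 * (1 - (\<Sum>b\<in>B. (b \<bullet> u i)\<^sup>2)) \<le> (\<sigma> i)\<^sup>2 * (1 - (\<Sum>b\<in>B. (b \<bullet> u i)\<^sup>2))"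
      using \<sigma>[OF i] \<open>s \<ge> 0\<close> by (intro mult_right_mono power_mono) auto
    also have "\<dots> = (norm (\<sigma> i *\<^sub>R u i))\<^sup>2 - (\<Sum>b\<in>B. (b \<bullet> (\<sigma> i *\<^sub>R u i))\<^sup>2)"
      by (simp add: nu[OF i] power_mult_distrib right_diff_distrib sum_distrib_left)
    also have "\<dots> \<le> (norm (X *v v i - \<sigma> i *\<^sub>R u i))\<^sup>2"
      unfolding c by (rule orthonormal_dist_span[OF oB])
    finally show ?thesis by (simp add: matrix_vector_mult_diff_rdistrib Mv)
  qed
  have "(\<Sum>i\<in>I. \<Sum>b\<in>B. (b \<bullet> u i)\<^sup>2) = (\<Sum>b\<in>B. \<Sum>i\<in>I. (u i \<bullet> b)\<^sup>2)"
    by (subst sum.swap) (simp add: inner_commute)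
  also have "\<dots> \<le> (\<Sum>b\<in>B. 1)"
    using bessel_inequality[OF u] B(3) by (intro sum_mono) (metis one_power2)
  also have "\<dots> = rank X" by (simp add: B(5) rank_dim_range)
  finally have "s\<^sup>2 * (real (card I) - real (rank X)) \<le> s\<^sup>2 * (real (card I) - (\<Sum>i\<in>I. \<Sum>b\<in>B. (b \<bullet> u i)\<^sup>2))"
    by (intro mult_left_mono) auto
  also have "\<dots> = (\<Sum>i\<in>I. s\<^sup>2 * (1 - (\<Sum>b\<in>B. (b \<bullet> u i)\<^sup>2)))"
    by (simp add: sum_subtractf flip: sum_distrib_left)
  also have "\<dots> \<le> (\<Sum>i\<in>I. (norm ((X - ?M) *v v i))\<^sup>2)" by (intro sum_mono each)
  also have "\<dots> = (\<Sum>i\<in>I. \<Sum>a\<in>UNIV. (v i \<bullet> (X - ?M) $ a)\<^sup>2)"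
    by (simp add: norm_vec_def L2_set_def sum_nonneg matrix_mult_dot inner_commute)
  also have "\<dots> = (\<Sum>a\<in>UNIV. \<Sum>i\<in>I. (v i \<bullet> (X - ?M) $ a)\<^sup>2)" by (rule sum.swap)
  also have "\<dots> \<le> (norm (X - ?M))\<^sup>2"
    unfolding norm_sq_rows by (intro sum_mono bessel_inequality v)
  finally show ?thesis .
qed

text \<open>Homogeneity reduces to the unit sphere; boundedness of \<open>A\<close> ensures that the
  supremum there is a genuine upper bound.\<close>

lemma restricted_eigenvalue_bounds:
  fixes A :: "real^'n^'m \<Rightarrow> real^'p"
  assumes "linear A" "rank X \<le> k"
  shows "restricted_min_eigenvalue k A * (norm X)\<^sup>2 \<le> (norm (A X))\<^sup>2"
    and "(norm (A X))\<^sup>2 \<le> restricted_max_eigenvalue k A * (norm X)\<^sup>2"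
proof -
  let ?S = "{X \<in> rank_le k. norm X = 1} :: (real^'n^'m) set"
  obtain K where K: "\<And>X. norm (A X) \<le> K * norm X"
    using linear_bounded[OF assms(1)] by blast
  have "bdd_below ((\<lambda>X. (norm (A X))\<^sup>2) ` ?S)" by (rule bdd_belowI[of _ 0]) auto
  moreover have "bdd_above ((\<lambda>X. (norm (A X))\<^sup>2) ` ?S)"
    by (rule bdd_aboveI[of _ "K\<^sup>2"]) (use K in \<open>auto intro!: power_mono, metis mult.right_neutral\<close>)
  ultimately have *: "restricted_min_eigenvalue k A \<le> (norm (A Y))\<^sup>2"
    "(norm (A Y))\<^sup>2 \<le> restricted_max_eigenvalue k A" if "Y \<in> ?S" for Y
    using that unfolding restricted_min_eigenvalue_def restricted_max_eigenvalue_def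
    by (auto intro: cINF_lower cSUP_upper)
  have "restricted_min_eigenvalue k A * (norm X)\<^sup>2 \<le> (norm (A X))\<^sup>2 \<and>
    (norm (A X))\<^sup>2 \<le> restricted_max_eigenvalue k A * (norm X)\<^sup>2"
  proof (cases "X = 0")
    case False
    have "rank (X /\<^sub>R norm X) \<le> k" using rank_scaleR_le assms(2) le_trans by blast
    then have "X /\<^sub>R norm X \<in> ?S" using False by (simp add: rank_le_def)
    from *[OF this] False show ?thesis
      by (simp add: linear_scale[OF assms(1)] power_mult_distrib field_simps)
  qed (simp add: linear_0[OF assms(1)])
  then show "restricted_min_eigenvalue k A * (norm X)\<^sup>2 \<le> (norm (A X))\<^sup>2"
    and "(norm (A X))\<^sup>2 \<le> restricted_max_eigenvalue k A * (norm X)\<^sup>2" by auto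
qed

text \<open>Polarization for the normalized vectors: \<open>A h \<bullet> A w\<close> is a quarter
  of the difference of the squared norms at \<open>h + w\<close> and \<open>h - w\<close>. The
  bounds with \<alpha> and \<beta> are required only on the span of \<open>H\<close> and
  \<open>W\<close>.\<close>

lemma restricted_inner_lower_bound:
  fixes A :: "'a::real_inner \<Rightarrow> 'b::real_inner"
  assumes A: "linear A"
    and bd: "\<And>a b. \<alpha> * (norm (a *\<^sub>R H + b *\<^sub>R W))\<^sup>2 \<le> (norm (A (a *\<^sub>R H + b *\<^sub>R W)))\<^sup>2 \<and>
      (norm (A (a *\<^sub>R H + b *\<^sub>R W)))\<^sup>2 \<le> \<beta> * (norm (a *\<^sub>R H + b *\<^sub>R W))\<^sup>2"
  shows "(\<alpha> + \<beta>) / 2 * (H \<bullet> W) - (\<beta> - \<alpha>) / 2 * (norm H * norm W) \<le> A H \<bullet> A W"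
proof (cases "H = 0 \<or> W = 0")
  case False
  define h w where "h = H /\<^sub>R norm H" and "w = W /\<^sub>R norm W"
  have n: "norm h = 1" "norm w = 1" using False by (auto simp: h_def w_def)
  have "\<alpha> * (norm (h + w))\<^sup>2 \<le> (norm (A (h + w)))\<^sup>2"
    using bd[of "inverse (norm H)" "inverse (norm W)"] by (simp add: h_def w_def)
  moreover have "(norm (A (h - w)))\<^sup>2 \<le> \<beta> * (norm (h - w))\<^sup>2"
    using bd[of "inverse (norm H)" "- inverse (norm W)"] by (simp add: h_def w_def)
  moreover have sq: "(norm (x + y))\<^sup>2 = (norm x)\<^sup>2 + 2 * (x \<bullet> y) + (norm y)\<^sup>2"
    "(norm (x - y))\<^sup>2 = (norm x)\<^sup>2 - 2 * (x \<bullet> y) + (norm y)\<^sup>2" for x y :: "'c::real_inner"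
    unfolding power2_norm_eq_inner by (simp_all add: inner_add_left inner_add_right inner_diff_left inner_diff_right inner_commute)
  ultimately have "\<alpha> * (2 + 2 * (h \<bullet> w)) - \<beta> * (2 - 2 * (h \<bullet> w)) \<le> 4 * (A h \<bullet> A w)"
    by (simp add: linear_add[OF A] linear_diff[OF A] sq n)
  then have "(\<alpha> + \<beta>) / 2 * (h \<bullet> w) - (\<beta> - \<alpha>) / 2 \<le> A h \<bullet> A w"
    by (simp add: field_simps)
  then have "norm H * norm W * ((\<alpha> + \<beta>) / 2 * (h \<bullet> w) - (\<beta> - \<alpha>) / 2) \<le> norm H * norm W * (A h \<bullet> A w)"
    by (intro mult_left_mono) auto
  moreover have "norm H * norm W * (h \<bullet> w) = H \<bullet> W" "norm H * norm W * (A h \<bullet> A w) = A H \<bullet> A W"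
    using False by (simp_all add: h_def w_def linear_scale[OF A] field_simps)
  ultimately show ?thesis by (simp add: algebra_simps)
qed (auto simp: linear_0[OF A])

text \<open>Comparison with \<open>M\<close>, whose loss is 0, gives \<open>rank X \<le> r\<close>,
  so \<alpha> applies to \<open>X - M\<close>. Losing \<open>d\<close> units of rank raises the
  weighted loss by at least \<open>\<nu> * \<alpha> * s\<^sup>2 / 2 * d\<close>, a factor above 2,
  but saves only \<open>d\<close>. Hence \<open>d = 0\<close>, and then the loss forces
  \<open>X = M\<close>.\<close>

lemma rank_reg_solution_unique:
  fixes A :: "real^'n^'m \<Rightarrow> real^'p" and u :: "nat \<Rightarrow> real^'m" and v :: "nat \<Rightarrow> real^'n"
  assumes u: "orthonormal {1..r} u" and v: "orthonormal {1..r} v"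
    and M: "M = rank_one_sum {1..r} \<sigma> u v"
    and s: "s > 0" and \<sigma>: "\<And>i. i \<in> {1..r} \<Longrightarrow> s \<le> \<sigma> i"
    and rank: "rank M = r" and A: "linear A" and "\<nu> > 0"
    and \<alpha>: "\<alpha> = restricted_min_eigenvalue (2 * r) A" "\<alpha> > 4 / (\<nu> * s\<^sup>2)"
    and X: "X \<in> rank_reg_solutions \<nu> A M"
  shows "X = M"
proof -
  have "\<alpha> > 0" using \<alpha>(2) s \<open>\<nu> > 0\<close> by (smt (verit) divide_pos_pos mult_pos_pos zero_less_power)
  have le: "\<nu> * loss A M X + real (rank X) \<le> real r"
    using X rank by (auto simp: rank_reg_solutions_def loss_def dest: spec[of _ M])
  have "loss A M X \<ge> 0" by (simp add: loss_def)
  then have Xr: "rank X \<le> r" using le \<open>\<nu> > 0\<close> by (smt (verit) mult_nonneg_nonneg of_nat_le_iff)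
  have "rank (X - M) \<le> 2 * r" using rank_diff_le[of X M] Xr rank by simp
  from restricted_eigenvalue_bounds(1)[OF A this]
  have loss: "\<nu> * (\<alpha> * (norm (X - M))\<^sup>2) / 2 \<le> \<nu> * loss A M X"
    using \<open>\<nu> > 0\<close> by (simp add: \<alpha>(1) loss_def linear_diff[OF A])
  have "\<nu> * (\<alpha> * (s\<^sup>2 * (real r - real (rank X)))) / 2 \<le> \<nu> * (\<alpha> * (norm (X - M))\<^sup>2) / 2"
    using rank_approximation_lower_bound[OF u v, of s \<sigma> X] s \<sigma> \<open>\<nu> > 0\<close> \<open>\<alpha> > 0\<close> by (simp add: M)
  then have "(\<nu> * \<alpha> * s\<^sup>2 / 2) * (real r - real (rank X)) \<le> real r - real (rank X)"
    using loss le by (simp add: mult_ac)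
  moreover have "\<nu> * \<alpha> * s\<^sup>2 / 2 > 2"
  proof -
    have "\<nu> * s\<^sup>2 > 0" using s \<open>\<nu> > 0\<close> by simp
    then have "4 < \<alpha> * (\<nu> * s\<^sup>2)" using \<alpha>(2) by (simp only: pos_divide_less_eq)
    also have "\<dots> = \<nu> * \<alpha> * s\<^sup>2" by (simp only: mult_ac)
    finally show ?thesis by simp
  qed
  moreover have "d \<le> 0" if "x * d \<le> d" "x > 2" for x d :: real
    using that by (smt (verit) mult_less_cancel_right1)
  ultimately have "real r - real (rank X) \<le> 0" by blast
  then have "rank X = r" using Xr by simp
  then have "\<nu> * (\<alpha> * (norm (X - M))\<^sup>2) / 2 \<le> 0" using le loss by simp
  then show ?thesis using \<open>\<nu> > 0\<close> \<open>\<alpha> > 0\<close>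
    by (simp add: mult_le_0_iff)
qed

section \<open>Subdifferentials\<close>

text \<open>Clearing the denominator replaces the extended-real liminf by an eventual inequality
  with slack \<open>e * norm (y - x)\<close>.\<close>

lemma regular_subdifferential_iff:
  "v \<in> regular_subdifferential g x \<longleftrightarrow>
    (\<forall>e>0. \<forall>\<^sub>F y in at x. - (e * norm (y - x)) \<le> g y - g x - v \<bullet> (y - x))"
proof -
  let ?q = "\<lambda>y. (g y - g x - v \<bullet> (y - x)) / norm (y - x)"
  have "v \<in> regular_subdifferential g x \<longleftrightarrow> (\<forall>c<0. \<forall>\<^sub>F y in at x. c < ereal (?q y))"
    by (simp add: regular_subdifferential_def le_Liminf_iff)
  also have "\<dots> \<longleftrightarrow> (\<forall>e>0. \<forall>\<^sub>F y in at x. - e \<le> ?q y)"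
  proof (intro iffI allI impI)
    fix e :: real assume "\<forall>c<0. \<forall>\<^sub>F y in at x. c < ereal (?q y)" "e > 0"
    then have "\<forall>\<^sub>F y in at x. ereal (- e) < ereal (?q y)"
      by (metis ereal_less(2) ereal_uminus_less_reorder uminus_ereal.simps(1) ereal_uminus_zero)
    then show "\<forall>\<^sub>F y in at x. - e \<le> ?q y" by eventually_elim simp
  next
    fix c :: ereal assume *: "\<forall>e>0. \<forall>\<^sub>F y in at x. - e \<le> ?q y" "c < 0"
    \<comment> \<open>Since \<open>c\<close> may be minus infinity, a real number between
      \<open>c\<close> and 0 takes its place.\<close>
    obtain d where d: "c < ereal d" "d < 0"
      using ereal_dense2[OF \<open>c < 0\<close>] by auto
    have "\<forall>\<^sub>F y in at x. - (- d) \<le> ?q y" using *(1) d(2) by (meson neg_0_less_iff_less)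
    then show "\<forall>\<^sub>F y in at x. c < ereal (?q y)"
      by eventually_elim (use d(1) in \<open>simp add: less_le_trans\<close>)
  qed
  also have "\<dots> \<longleftrightarrow> (\<forall>e>0. \<forall>\<^sub>F y in at x. - (e * norm (y - x)) \<le> g y - g x - v \<bullet> (y - x))"
  proof (intro all_cong eventually_cong)
    show "(- e \<le> ?q y) = (- (e * norm (y - x)) \<le> g y - g x - v \<bullet> (y - x))" if "y \<noteq> x" for e y
      using that by (simp add: pos_le_divide_eq)
  qed (simp add: eventually_at_filter)
  finally show ?thesis .
qed

lemma has_derivative_inner_bounds:
  fixes h :: "'a::real_inner \<Rightarrow> real"
  assumes "(h has_derivative (\<lambda>d. G \<bullet> d)) (at x)" and "e > 0"
  shows "\<forall>\<^sub>F y in at x. \<bar>h y - h x - G \<bullet> (y - x)\<bar> \<le> e * norm (y - x)"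
  using assms unfolding has_derivative_within_alt2 by (simp add: real_norm_def)

lemma gradient_in_regular_subdifferential:
  fixes h :: "'a::real_inner \<Rightarrow> real"
  assumes h: "(h has_derivative (\<lambda>d. G \<bullet> d)) (at x)"
    and g: "\<forall>\<^sub>F y in at x. h y - h x \<le> g y - g x"
  shows "G \<in> regular_subdifferential g x"
  unfolding regular_subdifferential_iff
proof (intro allI impI)
  fix e :: real assume "e > 0"
  show "\<forall>\<^sub>F y in at x. - (e * norm (y - x)) \<le> g y - g x - G \<bullet> (y - x)"
    using has_derivative_inner_bounds[OF h \<open>e > 0\<close>] g by eventually_elim linarith
qed

text \<open>Along the ray \<open>x + t *\<^sub>R d\<close> with \<open>t\<close> decreasing to 0
  both first-order estimates hold for the same increment; division by \<open>t\<close> leaves an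
  error of two slacks.\<close>

lemma regular_subgradient_le_derivative:
  fixes h :: "'a::real_inner \<Rightarrow> real"
  assumes h: "(h has_derivative (\<lambda>d. G \<bullet> d)) (at x)" and v: "v \<in> regular_subdifferential g x"
    and gh: "\<forall>\<^sub>F t in at (0::real). g (x + t *\<^sub>R d) - g x = h (x + t *\<^sub>R d) - h x"
  shows "v \<bullet> d \<le> G \<bullet> d"
proof (cases "d = 0")
  case False
  have lim: "filterlim (\<lambda>t. x + t *\<^sub>R d) (at x) (at_right 0)"
    unfolding filterlim_at
  proof
    have "((\<lambda>t. x + t *\<^sub>R d) \<longlongrightarrow> x + 0 *\<^sub>R d) (at_right 0)" by (intro tendsto_intros)
    then show "((\<lambda>t. x + t *\<^sub>R d) \<longlongrightarrow> x) (at_right 0)" by simp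
    show "\<forall>\<^sub>F t in at_right 0. x + t *\<^sub>R d \<in> UNIV \<and> x + t *\<^sub>R d \<noteq> x"
      using False by (auto simp: eventually_at_right_less intro!: eventually_mono[OF eventually_at_right_less])
  qed
  have gh': "\<forall>\<^sub>F t in at_right 0. g (x + t *\<^sub>R d) - g x = h (x + t *\<^sub>R d) - h x"
    using gh by (simp add: eventually_at_split)
  have le: "v \<bullet> d - G \<bullet> d \<le> 2 * e * norm d" if "e > 0" for e
  proof -
    have "\<forall>\<^sub>F t in at_right (0::real). v \<bullet> d - G \<bullet> d \<le> 2 * e * norm d"
      using filterlim_iff[THEN iffD1, OF lim, rule_format, OF has_derivative_inner_bounds[OF h \<open>e > 0\<close>]]
        filterlim_iff[THEN iffD1, OF lim, rule_format, OF v[unfolded regular_subdifferential_iff, rule_format, OF \<open>e > 0\<close>]]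
        gh' eventually_at_right_less[of "0::real"]
    proof eventually_elim
      case (elim t)
      then have "t * (v \<bullet> d - G \<bullet> d) \<le> t * (2 * e * norm d)"
        by (simp add: algebra_simps abs_le_iff)
      then show ?case using elim by simp
    qed
    then show ?thesis by (simp add: eventually_const_iff)
  qed
  show ?thesis
  proof (rule ccontr)
    assume "\<not> ?thesis"
    then have pos: "v \<bullet> d - G \<bullet> d > 0" by simp
    \<comment> \<open>With this slack the error \<open>2 * e * norm d\<close> is half of the
      supposed gap.\<close>
    with False have "(v \<bullet> d - G \<bullet> d) / (4 * norm d) > 0" by simp
    from le[OF this] pos False show False by simp
  qed
qed simp

text \<open>The agreement of \<open>g\<close> and \<open>h\<close> is two-sided in \<open>t\<close>,
  so the one-sided bound holds for \<open>d\<close> and for \<open>- d\<close>.\<close>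

lemma regular_subgradient_eq_derivative:
  fixes h :: "'a::real_inner \<Rightarrow> real"
  assumes h: "(h has_derivative (\<lambda>d. G \<bullet> d)) (at x)" and v: "v \<in> regular_subdifferential g x"
    and gh: "\<forall>\<^sub>F t in at (0::real). g (x + t *\<^sub>R d) - g x = h (x + t *\<^sub>R d) - h x"
  shows "v \<bullet> d = G \<bullet> d"
proof -
  have "filterlim uminus (at (0::real)) (at 0)"
    unfolding filterlim_at using tendsto_minus[OF tendsto_ident_at[of "0::real" UNIV]]
    by (simp add: eventually_at_filter)
  then have "\<forall>\<^sub>F t in at (0::real). g (x + (- t) *\<^sub>R d) - g x = h (x + (- t) *\<^sub>R d) - h x"
    using gh unfolding filterlim_iff by blast
  then have "v \<bullet> (- d) \<le> G \<bullet> (- d)"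
    using regular_subgradient_le_derivative[OF h v, of "- d"] by simp
  then show ?thesis using regular_subgradient_le_derivative[OF h v gh] by simp
qed

text \<open>A nonzero column stays nonzero under small changes. This makes the column count lower
  semicontinuous.\<close>

lemma eventually_colsupp_subset:
  fixes U :: "real^'k^'m"
  assumes "(W \<longlongrightarrow> U) F"
  shows "\<forall>\<^sub>F x in F. colsupp U \<subseteq> colsupp (W x)"
proof -
  have "\<forall>\<^sub>F x in F. column j (W x) \<noteq> 0" if "j \<in> colsupp U" for j
  proof (rule tendsto_imp_eventually_ne)
    have "((\<lambda>x. W x *v axis j 1) \<longlongrightarrow> U *v axis j 1) F"
      unfolding matrix_vector_mult_def by (intro tendsto_intros assms)
    then show "((\<lambda>x. column j (W x)) \<longlongrightarrow> column j U) F" by (simp add: column_eq_mult_axis)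
  qed (use that in \<open>simp add: colsupp_def\<close>)
  then have "\<forall>\<^sub>F x in F. \<forall>j\<in>colsupp U. column j (W x) \<noteq> 0"
    by (intro eventually_ball_finite) auto
  then show ?thesis by eventually_elim (auto simp: colsupp_def)
qed

section \<open>The smooth part of the objective and the subgradients of the whole\<close>

definition smooth_part ::
    "real \<Rightarrow> real \<Rightarrow> (real^'n^'m \<Rightarrow> real^'p) \<Rightarrow> real^'n^'m \<Rightarrow> (real^'k^'m) \<times> (real^'k^'n) \<Rightarrow> real" where
  "smooth_part \<nu> \<mu> A M = (\<lambda>(U, V).
     \<nu> * loss A M (U ** transpose V) + \<mu> / 4 * (norm (transpose U ** U - transpose V ** V))\<^sup>2)"

definition smooth_gradient ::
    "real \<Rightarrow> real \<Rightarrow> (real^'n^'m \<Rightarrow> real^'p) \<Rightarrow> real^'n^'m \<Rightarrow>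
      (real^'k^'m) \<times> (real^'k^'n) \<Rightarrow> (real^'k^'m) \<times> (real^'k^'n)" where
  "smooth_gradient \<nu> \<mu> A M = (\<lambda>(U, V).
     let G = adjoint A (A (U ** transpose V) - A M); E = transpose U ** U - transpose V ** V
     in (\<nu> *\<^sub>R (G ** V) + \<mu> *\<^sub>R (U ** E), \<nu> *\<^sub>R (transpose G ** U) - \<mu> *\<^sub>R (V ** E)))"

lemma Psi_smooth_part:
  "Psi \<nu> \<mu> A M x = smooth_part \<nu> \<mu> A M x
    + (real (card (colsupp (fst x))) + real (card (colsupp (snd x)))) / 2"
  by (simp add: Psi_def smooth_part_def nonzero_columns_colsupp split: prod.split)

lemma has_derivative_matrix_mult:
  assumes "(f has_derivative f') (at x within S)" "(g has_derivative g') (at x within S)"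
  shows "((\<lambda>x. f x ** g x :: real^'c^'a) has_derivative (\<lambda>d. f x ** g' d + f' d ** g x)) (at x within S)"
  using matrix_mult.FDERIV[OF assms] .

lemmas has_derivative_transpose = bounded_linear.has_derivative[OF bounded_linear_transpose]

text \<open>The chain rule, with all factors moved off the direction by adjointness. Symmetry of
  \<open>E\<close> makes both terms of the derivative of a Gram matrix contribute equally, which
  turns the weight \<open>\<mu> / 4\<close> into \<mu>.\<close>

lemma smooth_part_has_derivative:
  fixes A :: "real^'n^'m \<Rightarrow> real^'p" and x :: "(real^'k^'m) \<times> (real^'k^'n)"
  assumes A: "linear A"
  shows "(smooth_part \<nu> \<mu> A M has_derivative (\<lambda>d. smooth_gradient \<nu> \<mu> A M x \<bullet> d)) (at x)"
proof -
  obtain U V where x: "x = (U, V)" by (cases x)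
  define E where "E = transpose U ** U - transpose V ** V"
  define e where "e = A (U ** transpose V) - A M"
  have symE: "transpose E = E"
    by (simp add: E_def transpose_diff matrix_transpose_mul)
  have bA: "bounded_linear A" using A linear_conv_bounded_linear by blast
  let ?f = "\<lambda>y. A (fst y ** transpose (snd y)) - A M"
  let ?f' = "\<lambda>d. A (U ** transpose (snd d) + fst d ** transpose V)"
  have df: "(?f has_derivative ?f') (at x)"
  proof -
    have "((\<lambda>y. fst y ** transpose (snd y)) has_derivative
        (\<lambda>d. fst x ** transpose (snd d) + fst d ** transpose (snd x))) (at x)"
      by (intro has_derivative_matrix_mult has_derivative_transpose has_derivative_fst
          has_derivative_snd has_derivative_ident)
    from has_derivative_diff[OF bounded_linear.has_derivative[OF bA this] has_derivative_const]
    show ?thesis by (simp add: x)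
  qed
  let ?g = "\<lambda>y. transpose (fst y) ** fst y - transpose (snd y) ** snd y"
  let ?g' = "\<lambda>d. (transpose U ** fst d + transpose (fst d) ** U) - (transpose V ** snd d + transpose (snd d) ** V)"
  have dg: "(?g has_derivative ?g') (at x)"
  proof -
    have "(?g has_derivative
        (\<lambda>d. (transpose (fst x) ** fst d + transpose (fst d) ** fst x)
          - (transpose (snd x) ** snd d + transpose (snd d) ** snd x))) (at x)"
      by (intro has_derivative_diff has_derivative_matrix_mult has_derivative_transpose
          has_derivative_fst has_derivative_snd has_derivative_ident)
    then show ?thesis by (simp add: x)
  qed
  have eq: "smooth_part \<nu> \<mu> A M = (\<lambda>y. \<nu> / 2 * (?f y \<bullet> ?f y) + \<mu> / 4 * (?g y \<bullet> ?g y))"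
    by (simp add: fun_eq_iff smooth_part_def loss_def power2_norm_eq_inner)
  have "(smooth_part \<nu> \<mu> A M has_derivative
      (\<lambda>d. \<nu> / 2 * (?f x \<bullet> ?f' d + ?f' d \<bullet> ?f x) + \<mu> / 4 * (?g x \<bullet> ?g' d + ?g' d \<bullet> ?g x))) (at x)"
    unfolding eq by (intro has_derivative_add has_derivative_mult_right has_derivative_inner df dg)
  moreover have "\<nu> / 2 * (?f x \<bullet> ?f' d + ?f' d \<bullet> ?f x) + \<mu> / 4 * (?g x \<bullet> ?g' d + ?g' d \<bullet> ?g x)
      = smooth_gradient \<nu> \<mu> A M x \<bullet> d" for d
  proof -
    obtain P Q where d: "d = (P, Q)" by (cases d)
    have G: "e \<bullet> A X = adjoint A e \<bullet> X" for X by (simp add: adjoint_clauses(2)[OF A])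
    have 1: "e \<bullet> A (U ** transpose Q + P ** transpose V)
        = (adjoint A e ** V) \<bullet> P + (transpose (adjoint A e) ** U) \<bullet> Q"
    proof -
      have "adjoint A e \<bullet> (U ** transpose Q) = (transpose (adjoint A e) ** U) \<bullet> Q"
        using inner_transpose[of "adjoint A e" "U ** transpose Q"]
        by (simp add: matrix_transpose_mul inner_matrix_mult_right inner_commute)
      moreover have "adjoint A e \<bullet> (P ** transpose V) = (adjoint A e ** V) \<bullet> P"
        using inner_matrix_mult_right[of P "transpose V" "adjoint A e"] by (simp add: inner_commute)
      ultimately show ?thesis by (simp add: G inner_add_right)
    qed
    have 2: "E \<bullet> (transpose W ** P + transpose P ** W) = 2 * ((W ** E) \<bullet> P)"
      for W P :: "real^'k^'l"
    proof -
      have "E \<bullet> (transpose P ** W) = E \<bullet> (transpose W ** P)"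
        using inner_transpose[of E "transpose P ** W"] by (simp add: symE matrix_transpose_mul)
      moreover have "E \<bullet> (transpose W ** P) = (W ** E) \<bullet> P"
        by (simp add: inner_matrix_mult_left)
      ultimately show ?thesis by (simp add: inner_add_right)
    qed
    have "\<nu> / 2 * (?f x \<bullet> ?f' d + ?f' d \<bullet> ?f x) + \<mu> / 4 * (?g x \<bullet> ?g' d + ?g' d \<bullet> ?g x)
      = \<nu> * (e \<bullet> A (U ** transpose Q + P ** transpose V))
       + \<mu> / 2 * (E \<bullet> (transpose U ** P + transpose P ** U) - E \<bullet> (transpose V ** Q + transpose Q ** V))"
      by (simp add: x d e_def[symmetric] E_def[symmetric] inner_commute inner_diff_right inner_diff_left)
    also have "\<dots> = smooth_gradient \<nu> \<mu> A M x \<bullet> d"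
      unfolding 1 2
      by (simp add: x d smooth_gradient_def Let_def e_def[symmetric] E_def[symmetric]
          inner_add_left inner_diff_left algebra_simps)
    finally show ?thesis .
  qed
  ultimately show ?thesis by simp
qed

lemma tendsto_transpose: "(f \<longlongrightarrow> l) F \<Longrightarrow> ((\<lambda>x. transpose (f x :: real^'b^'a)) \<longlongrightarrow> transpose l) F"
  by (rule bounded_linear.tendsto[OF bounded_linear_transpose])

lemma tendsto_linear:
  fixes f :: "'a::euclidean_space \<Rightarrow> 'b::real_normed_vector"
  shows "linear f \<Longrightarrow> (g \<longlongrightarrow> l) F \<Longrightarrow> ((\<lambda>x. f (g x)) \<longlongrightarrow> f l) F"
  by (simp add: bounded_linear.tendsto linear_conv_bounded_linear)

lemma tendsto_smooth_gradient:
  fixes A :: "real^'n^'m \<Rightarrow> real^'p" and x :: "(real^'k^'m) \<times> (real^'k^'n)"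
  assumes A: "linear A" and xs: "(xs \<longlongrightarrow> x) F"
  shows "((\<lambda>i. smooth_gradient \<nu> \<mu> A M (xs i)) \<longlongrightarrow> smooth_gradient \<nu> \<mu> A M x) F"
  unfolding smooth_gradient_def case_prod_beta Let_def
  by (intro tendsto_Pair tendsto_add tendsto_diff tendsto_scaleR tendsto_const matrix_mult.tendsto
      tendsto_transpose tendsto_fst tendsto_snd tendsto_linear[OF A]
      tendsto_linear[OF adjoint_linear[OF A]] xs)

text \<open>Near \<open>x\<close> the supports can only grow, so increments of \<open>Psi\<close>
  dominate those of the smooth part and the gradient is already a regular subgradient.\<close>

lemma smooth_gradient_in_limiting_subdifferential:
  fixes A :: "real^'n^'m \<Rightarrow> real^'p" and x :: "(real^'k^'m) \<times> (real^'k^'n)"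
  assumes A: "linear A"
  shows "smooth_gradient \<nu> \<mu> A M x \<in> limiting_subdifferential (Psi \<nu> \<mu> A M) x"
proof -
  have lim: "((\<lambda>y. fst y) \<longlongrightarrow> fst x) (at x)" "((\<lambda>y. snd y) \<longlongrightarrow> snd x) (at x)"
    by (auto intro!: tendsto_intros)
  have "\<forall>\<^sub>F y in at x. smooth_part \<nu> \<mu> A M y - smooth_part \<nu> \<mu> A M x \<le> Psi \<nu> \<mu> A M y - Psi \<nu> \<mu> A M x"
    using eventually_colsupp_subset[OF lim(1)] eventually_colsupp_subset[OF lim(2)]
  proof eventually_elim
    case (elim y)
    then have "card (colsupp (fst x)) \<le> card (colsupp (fst y))" "card (colsupp (snd x)) \<le> card (colsupp (snd y))"
      by (simp_all add: card_mono)
    then show ?case by (simp add: Psi_smooth_part)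
  qed
  then have "smooth_gradient \<nu> \<mu> A M x \<in> regular_subdifferential (Psi \<nu> \<mu> A M) x"
    by (rule gradient_in_regular_subdifferential[OF smooth_part_has_derivative[OF A]])
  then show ?thesis
    unfolding limiting_subdifferential_def
    by (intro CollectI exI[of _ "\<lambda>_. x"] exI[of _ "\<lambda>_. smooth_gradient \<nu> \<mu> A M x"]) auto
qed

text \<open>A move within the column supports cannot enlarge them, and a small move cannot shrink
  them. The counts are thus constant along \<open>d\<close>, and \<open>Psi\<close> changes like its
  smooth part.\<close>

lemma regular_subgradient_Psi:
  fixes A :: "real^'n^'m \<Rightarrow> real^'p" and x :: "(real^'k^'m) \<times> (real^'k^'n)"
  assumes A: "linear A" and v: "v \<in> regular_subdifferential (Psi \<nu> \<mu> A M) x"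
    and d: "colsupp (fst d) \<subseteq> colsupp (fst x)" "colsupp (snd d) \<subseteq> colsupp (snd x)"
  shows "v \<bullet> d = smooth_gradient \<nu> \<mu> A M x \<bullet> d"
proof (rule regular_subgradient_eq_derivative[OF smooth_part_has_derivative[OF A] v])
  have supp: "colsupp (U + t *\<^sub>R P) \<subseteq> colsupp U" if "colsupp P \<subseteq> colsupp U"
    for U P :: "real^'k^'l" and t
  proof
    fix j assume "j \<in> colsupp (U + t *\<^sub>R P)"
    moreover have "column j (U + t *\<^sub>R P) = column j U + t *\<^sub>R column j P"
      by (simp add: column_def vec_eq_iff)
    ultimately show "j \<in> colsupp U" using that by (auto simp: colsupp_def)
  qed
  have "((\<lambda>t. fst x + t *\<^sub>R fst d) \<longlongrightarrow> fst x + 0 *\<^sub>R fst d) (at 0)"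
    "((\<lambda>t. snd x + t *\<^sub>R snd d) \<longlongrightarrow> snd x + 0 *\<^sub>R snd d) (at 0)"
    by (intro tendsto_intros)+
  from this[THEN eventually_colsupp_subset]
  show "\<forall>\<^sub>F t in at 0. Psi \<nu> \<mu> A M (x + t *\<^sub>R d) - Psi \<nu> \<mu> A M x
      = smooth_part \<nu> \<mu> A M (x + t *\<^sub>R d) - smooth_part \<nu> \<mu> A M x"
  proof eventually_elim
    case (elim t)
    then have "colsupp (fst x + t *\<^sub>R fst d) = colsupp (fst x)" "colsupp (snd x + t *\<^sub>R snd d) = colsupp (snd x)"
      using supp[OF d(1), of t] supp[OF d(2), of t] by auto
    then show ?case by (simp add: Psi_smooth_part)
  qed
qed

text \<open>The supports of the approximating points eventually contain those of \<open>x\<close>,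
  so \<open>d\<close> is admissible for them as well; continuity of the smooth gradient carries the
  identity to the limit.\<close>

lemma limiting_subgradient_Psi:
  fixes A :: "real^'n^'m \<Rightarrow> real^'p" and x :: "(real^'k^'m) \<times> (real^'k^'n)"
  assumes A: "linear A" and v: "v \<in> limiting_subdifferential (Psi \<nu> \<mu> A M) x"
    and d: "colsupp (fst d) \<subseteq> colsupp (fst x)" "colsupp (snd d) \<subseteq> colsupp (snd x)"
  shows "v \<bullet> d = smooth_gradient \<nu> \<mu> A M x \<bullet> d"
proof -
  obtain xs vs where vs: "\<And>k::nat. vs k \<in> regular_subdifferential (Psi \<nu> \<mu> A M) (xs k)"
    and xs: "xs \<longlonglongrightarrow> x" and lim: "vs \<longlonglongrightarrow> v"
    using v unfolding limiting_subdifferential_def by blast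
  have "\<forall>\<^sub>F k in sequentially. vs k \<bullet> d = smooth_gradient \<nu> \<mu> A M (xs k) \<bullet> d"
    using eventually_colsupp_subset[OF tendsto_fst[OF xs]] eventually_colsupp_subset[OF tendsto_snd[OF xs]]
    by eventually_elim (use d in \<open>auto intro!: regular_subgradient_Psi[OF A vs]\<close>)
  moreover have "(\<lambda>k. smooth_gradient \<nu> \<mu> A M (xs k) \<bullet> d) \<longlonglongrightarrow> smooth_gradient \<nu> \<mu> A M x \<bullet> d"
    by (intro tendsto_intros tendsto_smooth_gradient A xs)
  ultimately have "(\<lambda>k. vs k \<bullet> d) \<longlonglongrightarrow> smooth_gradient \<nu> \<mu> A M x \<bullet> d"
    by (simp add: tendsto_cong)
  moreover have "(\<lambda>k. vs k \<bullet> d) \<longlonglongrightarrow> v \<bullet> d" by (intro tendsto_intros lim)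
  ultimately show ?thesis using LIMSEQ_unique by blast
qed

lemma column_matrix_mult: "column j ((X::real^'b^'a) ** (Y::real^'c^'b)) = X *v column j Y"
  by (simp add: column_eq_mult_axis matrix_vector_mul_assoc)

text \<open>Makes the gradient itself an admissible test direction for
  \<open>limiting_subgradient_Psi\<close>.\<close>

lemma colsupp_smooth_gradient:
  fixes A :: "real^'n^'m \<Rightarrow> real^'p" and U :: "real^'k^'m" and V :: "real^'k^'n"
  assumes "colsupp U = J" "colsupp V = J"
  shows "colsupp (fst (smooth_gradient \<nu> \<mu> A M (U, V))) \<subseteq> J"
    "colsupp (snd (smooth_gradient \<nu> \<mu> A M (U, V))) \<subseteq> J"
proof -
  have lin: "column j (a *\<^sub>R X) = a *\<^sub>R column j X" "column j (X + Y) = column j X + column j Y"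
    "column j (X - Y) = column j X - column j Y"
    for a j and X Y :: "real^'d^'l"
    by (simp_all add: column_def vec_eq_iff)
  have "column j (fst (smooth_gradient \<nu> \<mu> A M (U, V))) = 0 \<and>
    column j (snd (smooth_gradient \<nu> \<mu> A M (U, V))) = 0" if "j \<notin> J" for j
  proof -
    have "column j U = 0" "column j V = 0" using that assms by (auto simp: colsupp_def)
    then show ?thesis by (simp add: smooth_gradient_def Let_def lin column_matrix_mult)
  qed
  then show "colsupp (fst (smooth_gradient \<nu> \<mu> A M (U, V))) \<subseteq> J"
    "colsupp (snd (smooth_gradient \<nu> \<mu> A M (U, V))) \<subseteq> J"
    unfolding colsupp_def by blast+
qed

lemma infdist_limiting_subdifferential_Psi:
  fixes A :: "real^'n^'m \<Rightarrow> real^'p" and U :: "real^'k^'m" and V :: "real^'k^'n"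
  assumes A: "linear A" and "colsupp U = J" "colsupp V = J"
  shows "norm (smooth_gradient \<nu> \<mu> A M (U, V))
    \<le> infdist 0 (limiting_subdifferential (Psi \<nu> \<mu> A M) (U, V))"
proof -
  let ?g = "smooth_gradient \<nu> \<mu> A M (U, V)" and ?S = "limiting_subdifferential (Psi \<nu> \<mu> A M) (U, V)"
  \<comment> \<open>\<open>infdist\<close> to the empty set is 0 by convention, so a lower bound
    requires that a subgradient exists.\<close>
  have ne: "?S \<noteq> {}" using smooth_gradient_in_limiting_subdifferential[OF A] by blast
  have "norm ?g \<le> norm v" if "v \<in> ?S" for v
  proof -
    have "v \<bullet> ?g = ?g \<bullet> ?g"
      by (rule limiting_subgradient_Psi[OF A that])
         (use colsupp_smooth_gradient[OF assms(2,3)] assms in simp_all)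
    then have "norm ?g * norm ?g = v \<bullet> ?g"
      by (simp add: power2_norm_eq_inner flip: power2_eq_square)
    also have "\<dots> \<le> norm v * norm ?g" by (rule norm_cauchy_schwarz)
    finally show ?thesis by (cases "norm ?g = 0") auto
  qed
  then show ?thesis unfolding infdist_notempty[OF ne] by (intro cINF_greatest ne) auto
qed

section \<open>The gradient inequality\<close>

lemma norm_smooth_gradient:
  fixes A :: "real^'n^'m \<Rightarrow> real^'p" and M :: "real^'n^'m" and U :: "real^'k^'m" and V :: "real^'k^'n"
  defines "G \<equiv> adjoint A (A (U ** transpose V) - A M)"
    and "E \<equiv> transpose U ** U - transpose V ** V"
  shows "(norm (smooth_gradient \<nu> \<mu> A M (U, V)))\<^sup>2
    = \<nu>\<^sup>2 * ((norm (G ** V))\<^sup>2 + (norm (transpose G ** U))\<^sup>2) + \<mu>\<^sup>2 * ((norm (U ** E))\<^sup>2 + (norm (V ** E))\<^sup>2)"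
proof -
  have symE: "transpose E = E" by (simp add: E_def transpose_diff matrix_transpose_mul)
  have "(U ** E) \<bullet> (G ** V) = E \<bullet> (transpose U ** G ** V)"
    by (simp add: inner_matrix_mult_left matrix_mul_assoc)
  also have "\<dots> = E \<bullet> (transpose V ** transpose G ** U)"
    using inner_transpose[of E "transpose U ** G ** V"]
    by (simp add: symE matrix_transpose_mul matrix_mul_assoc)
  also have "\<dots> = (V ** E) \<bullet> (transpose G ** U)"
    by (simp add: inner_matrix_mult_left matrix_mul_assoc)
  finally have cross: "(G ** V) \<bullet> (U ** E) = (transpose G ** U) \<bullet> (V ** E)"
    by (simp add: inner_commute)
  have sq: "(norm (\<nu> *\<^sub>R x + \<mu> *\<^sub>R y))\<^sup>2 = \<nu>\<^sup>2 * (norm x)\<^sup>2 + 2 * \<nu> * \<mu> * (x \<bullet> y) + \<mu>\<^sup>2 * (norm y)\<^sup>2"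
    "(norm (\<nu> *\<^sub>R x - \<mu> *\<^sub>R y))\<^sup>2 = \<nu>\<^sup>2 * (norm x)\<^sup>2 - 2 * \<nu> * \<mu> * (x \<bullet> y) + \<mu>\<^sup>2 * (norm y)\<^sup>2"
    for x y :: "'z::real_inner"
    unfolding power2_norm_eq_inner
    by (simp_all add: inner_add_left inner_add_right inner_diff_left inner_diff_right inner_commute
        power2_eq_square algebra_simps)
  have "smooth_gradient \<nu> \<mu> A M (U, V) = (\<nu> *\<^sub>R (G ** V) + \<mu> *\<^sub>R (U ** E), \<nu> *\<^sub>R (transpose G ** U) - \<mu> *\<^sub>R (V ** E))"
    by (simp add: smooth_gradient_def G_def E_def Let_def)
  then have "(norm (smooth_gradient \<nu> \<mu> A M (U, V)))\<^sup>2
    = (norm (\<nu> *\<^sub>R (G ** V) + \<mu> *\<^sub>R (U ** E)))\<^sup>2 + (norm (\<nu> *\<^sub>R (transpose G ** U) - \<mu> *\<^sub>R (V ** E)))\<^sup>2"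
    by (simp add: norm_Pair)
  then show ?thesis unfolding sq cross by (simp add: algebra_simps)
qed

text \<open>Tests \<open>G\<close> against \<open>W = H ** V ** transpose V\<close>, for which
  \<open>G \<bullet> W\<close> is \<open>(G ** V) \<bullet> (H ** V)\<close> and
  \<open>H \<bullet> W\<close> is the squared norm of \<open>H ** V\<close>. As \<open>G\<close>
  enters only through inner products, the lemma also covers the transposed problem.\<close>

lemma gradient_factor_lower_bound:
  fixes A :: "real^'n^'m \<Rightarrow> 'p::real_inner" and U :: "real^'k^'m" and V :: "real^'k^'n"
  assumes A: "linear A"
    and bd: "\<And>X. rank X \<le> 2 * r \<Longrightarrow> \<alpha> * (norm X)\<^sup>2 \<le> (norm (A X))\<^sup>2 \<and> (norm (A X))\<^sup>2 \<le> \<beta> * (norm X)\<^sup>2"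
    and "\<alpha> \<le> \<beta>"
    and H: "H = U ** transpose V - M" and M: "rank M \<le> r" and V: "rank V \<le> r"
    and G: "\<And>X. G \<bullet> X = A H \<bullet> A X"
    and c: "\<And>x. norm (V *v x) \<le> c * norm x" "c \<ge> 0"
  shows "(\<alpha> + \<beta>) / 2 * norm (H ** V) \<le> norm (G ** V) + (\<beta> - \<alpha>) / 2 * (c * norm H)"
proof -
  define Z where "Z = H ** V"
  define W where "W = Z ** transpose V"
  \<comment> \<open>Both \<open>H\<close> and \<open>W\<close> end in \<open>transpose V\<close> up
    to a multiple of \<open>M\<close>, so a combination has rank at most
    \<open>r + r\<close>.\<close>
  have "rank (a *\<^sub>R H + b *\<^sub>R W) \<le> 2 * r" for a b
  proof -
    have "a *\<^sub>R H + b *\<^sub>R W = (a *\<^sub>R U + b *\<^sub>R Z) ** transpose V - a *\<^sub>R M"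
      by (simp add: H W_def matrix_mult.add_left matrix_mult.scaleR_left scaleR_diff_right)
    also have "rank \<dots> \<le> rank ((a *\<^sub>R U + b *\<^sub>R Z) ** transpose V) + rank (a *\<^sub>R M)"
      by (rule rank_diff_le)
    also have "\<dots> \<le> r + r"
      by (intro add_mono order_trans[OF rank_mul_le_right] order_trans[OF rank_scaleR_le] M)
         (simp add: rank_transpose V)
    finally show ?thesis by simp
  qed
  then have "(\<alpha> + \<beta>) / 2 * (H \<bullet> W) - (\<beta> - \<alpha>) / 2 * (norm H * norm W) \<le> A H \<bullet> A W"
    by (intro restricted_inner_lower_bound[OF A] bd)
  moreover have "A H \<bullet> A W \<le> norm (G ** V) * norm Z"
  proof -
    have "A H \<bullet> A W = (G ** V) \<bullet> Z"
      unfolding G[symmetric] W_def using inner_matrix_mult_right[of Z "transpose V" G]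
      by (simp add: inner_commute)
    then show ?thesis by (simp add: norm_cauchy_schwarz)
  qed
  moreover have HW: "H \<bullet> W = (norm Z)\<^sup>2"
    unfolding W_def using inner_matrix_mult_right[of Z "transpose V" H]
    by (simp add: inner_commute power2_norm_eq_inner Z_def)
  moreover have "(\<beta> - \<alpha>) / 2 * (norm H * norm W) \<le> (\<beta> - \<alpha>) / 2 * (norm H * (c * norm Z))"
  proof -
    have "norm W \<le> c * norm Z"
      unfolding W_def by (rule norm_le_rows) (simp_all add: row_mult_transpose c)
    then show ?thesis using \<open>\<alpha> \<le> \<beta>\<close> by (intro mult_left_mono) auto
  qed
  ultimately have "(\<alpha> + \<beta>) / 2 * (norm Z)\<^sup>2 \<le> norm (G ** V) * norm Z + (\<beta> - \<alpha>) / 2 * (norm H * (c * norm Z))"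
    unfolding HW by linarith
  then have "norm Z * ((\<alpha> + \<beta>) / 2 * norm Z) \<le> norm Z * (norm (G ** V) + (\<beta> - \<alpha>) / 2 * (c * norm H))"
    by (simp add: power2_eq_square algebra_simps)
  then have "(\<alpha> + \<beta>) / 2 * norm Z \<le> norm (G ** V) + (\<beta> - \<alpha>) / 2 * (c * norm H)" if "norm Z \<noteq> 0"
    using that by simp
  moreover have "0 \<le> norm (G ** V) + (\<beta> - \<alpha>) / 2 * (c * norm H)"
    using \<open>\<alpha> \<le> \<beta>\<close> c(2) by simp
  ultimately show ?thesis unfolding Z_def[symmetric] by fastforce
qed

text \<open>
  The ratio condition reads \<open>\<beta> - \<alpha> < (\<beta> + \<alpha>) t\<close> with \<open>t = \<sigma>r\<^sup>4 / Q\<close>, and \<open>\<surd>\<sigma>1 t \<le> \<surd>\<sigma>r / 3200\<close>; both error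
  terms and \<open>K\<close> itself are therefore negligible against the main term \<open>9/40 (\<alpha> + \<beta>) \<surd>\<sigma>r h\<close>.
\<close>

lemma gradient_constant_bound:
  fixes \<sigma>1 \<sigma>r \<alpha> \<beta> x y a b h :: real
  assumes \<sigma>: "0 < \<sigma>r" "\<sigma>r \<le> \<sigma>1" and \<alpha>: "0 < \<alpha>" "\<alpha> \<le> \<beta>"
    and ratio: "\<beta> / \<alpha> < (128 * \<sigma>1\<^sup>2 * (4 * \<sigma>1 + \<sigma>r)\<^sup>2 + \<sigma>r^4) / (128 * \<sigma>1\<^sup>2 * (4 * \<sigma>1 + \<sigma>r)\<^sup>2 - \<sigma>r^4)"
    and a: "(\<alpha> + \<beta>) / 2 * x \<le> a + (\<beta> - \<alpha>) / 2 * (5 / 4 * sqrt \<sigma>1 * h)"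
    and b: "(\<alpha> + \<beta>) / 2 * y \<le> b + (\<beta> - \<alpha>) / 2 * (5 / 4 * sqrt \<sigma>1 * h)"
    and h: "3 / 4 * sqrt \<sigma>r * h \<le> 5 / 3 * (x + y)" "h \<ge> 0"
  defines "K \<equiv> (\<beta> + \<alpha>) * \<sigma>r^4 / (128 * sqrt (\<sigma>1^3) * (4 * \<sigma>1 + \<sigma>r)\<^sup>2) - sqrt \<sigma>1 * (\<beta> - \<alpha>)"
  shows "0 \<le> K" "K * h \<le> a + b"
proof -
  define p q where "p = sqrt \<sigma>1" and "q = sqrt \<sigma>r"
  define Q where "Q = 128 * \<sigma>1\<^sup>2 * (4 * \<sigma>1 + \<sigma>r)\<^sup>2"
  define t where "t = \<sigma>r^4 / Q"
  have pq: "0 < q" "q \<le> p" "p\<^sup>2 = \<sigma>1" "q\<^sup>2 = \<sigma>r" "p > 0" using \<sigma> by (auto simp: p_def q_def)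
  have "\<sigma>1 > 0" using \<sigma> by simp
  then have Q: "Q > 0" using \<sigma> by (simp add: Q_def)
  \<comment> \<open>From \<open>4 * \<sigma>1 + \<sigma>r \<ge> 5 * \<sigma>r\<close>; then 3200 is
    128 times 25.\<close>
  have "25 * \<sigma>r\<^sup>2 \<le> (4 * \<sigma>1 + \<sigma>r)\<^sup>2"
    using power_mono[of "5 * \<sigma>r" "4 * \<sigma>1 + \<sigma>r" 2] \<sigma> by (simp add: power_mult_distrib)
  then have QQ: "3200 * \<sigma>1\<^sup>2 * \<sigma>r\<^sup>2 \<le> Q"
    unfolding Q_def using mult_left_mono[of "25 * \<sigma>r\<^sup>2" "(4 * \<sigma>1 + \<sigma>r)\<^sup>2" "128 * \<sigma>1\<^sup>2"] by simp
  have pt: "p * t \<le> q / 3200"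
  proof -
    \<comment> \<open>In the square roots \<open>p\<close> and \<open>q\<close>, after removing the
      common factor \<open>p * q ^ 5\<close>, this is \<open>q ^ 3 \<le> p ^ 3\<close>.\<close>
    have "3200 * (p * \<sigma>r^4) \<le> q * (3200 * \<sigma>1\<^sup>2 * \<sigma>r\<^sup>2)"
    proof -
      have "q ^ 3 \<le> p ^ 3" using pq by (intro power_mono) auto
      then have "3200 * (p * q ^ 5 * q ^ 3) \<le> 3200 * (p * q ^ 5 * p ^ 3)" using pq by (intro mult_left_mono) auto
      then show ?thesis unfolding pq(3,4)[symmetric] by (simp add: power_numeral_reduce algebra_simps)
    qed
    also have "\<dots> \<le> q * Q" using QQ pq by (intro mult_left_mono) auto
    finally show ?thesis using Q by (simp add: t_def field_simps)
  qed
  have "\<sigma>r ^ 4 < Q"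
  proof -
    have "\<sigma>r ^ 4 = \<sigma>r\<^sup>2 * \<sigma>r\<^sup>2" by (simp add: power_numeral_reduce)
    also have "\<dots> \<le> \<sigma>1\<^sup>2 * \<sigma>r\<^sup>2" using \<sigma> by (intro mult_right_mono power_mono) auto
    also have "\<dots> < 3200 * \<sigma>1\<^sup>2 * \<sigma>r\<^sup>2" using \<sigma> by simp
    finally show ?thesis using QQ by simp
  qed
  then have "\<beta> * (Q - \<sigma>r^4) < \<alpha> * (Q + \<sigma>r^4)"
    using ratio \<alpha> unfolding Q_def[symmetric] by (simp add: field_simps)
  then have "(\<beta> - \<alpha>) * Q \<le> (\<beta> + \<alpha>) * \<sigma>r^4" by (simp add: algebra_simps)
  then have gap: "\<beta> - \<alpha> \<le> (\<beta> + \<alpha>) * t" using Q by (simp add: t_def pos_le_divide_eq)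
  have sqrt3: "sqrt (\<sigma>1 ^ 3) = p ^ 3" by (simp add: p_def real_sqrt_power)
  \<comment> \<open>Exhibits \<open>K\<close> as \<open>p\<close> times
    \<open>(\<beta> + \<alpha>) * t - (\<beta> - \<alpha>)\<close>, which \<open>gap\<close> shows
    to be nonnegative.\<close>
  have "Q = p * (128 * sqrt (\<sigma>1^3) * (4 * \<sigma>1 + \<sigma>r)\<^sup>2)"
    unfolding sqrt3 Q_def by (simp add: power_numeral_reduce algebra_simps flip: pq(3))
  then have K: "K = p * ((\<beta> + \<alpha>) * t) - p * (\<beta> - \<alpha>)"
    using pq by (simp add: K_def t_def p_def)
  show "0 \<le> K" unfolding K using mult_left_mono[OF gap, of p] pq by simp
  have tp: "p * ((\<beta> + \<alpha>) * t) \<le> (\<beta> + \<alpha>) * q / 3200"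
    using mult_left_mono[OF pt, of "\<beta> + \<alpha>"] \<alpha> by (simp add: mult_ac)
  have gp: "p * (\<beta> - \<alpha>) \<le> (\<beta> + \<alpha>) * q / 3200"
    using order_trans[OF mult_left_mono[OF gap] tp] pq by simp
  have "K * h \<le> ((\<beta> + \<alpha>) * q / 3200) * h"
  proof (rule mult_right_mono)
    have "0 \<le> p * (\<beta> - \<alpha>)" using \<alpha> pq by simp
    then show "K \<le> (\<beta> + \<alpha>) * q / 3200" unfolding K using tp by linarith
  qed (rule h)
  moreover have "(p * (\<beta> - \<alpha>)) * h \<le> ((\<beta> + \<alpha>) * q / 3200) * h"
    by (intro mult_right_mono gp h)
  moreover have "(\<alpha> + \<beta>) / 2 * (9 / 20 * (q * h)) \<le> (\<alpha> + \<beta>) / 2 * (x + y)"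
    using h \<alpha> by (intro mult_left_mono) (auto simp: q_def)
  moreover have "(\<alpha> + \<beta>) / 2 * (x + y) \<le> a + b + 5 / 4 * ((p * (\<beta> - \<alpha>)) * h)"
  proof -
    have "(\<beta> - \<alpha>) / 2 * (5 / 4 * sqrt \<sigma>1 * h) = 5 / 8 * ((p * (\<beta> - \<alpha>)) * h)"
      by (simp add: p_def)
    then show ?thesis using a b unfolding distrib_left by linarith
  qed
  \<comment> \<open>In units of \<open>(\<beta> + \<alpha>) * q / 3200 * h\<close> the main term is
    720, the two errors together are at most 5/4, and \<open>K * h\<close> is at most 1.\<close>
  moreover have "(\<alpha> + \<beta>) / 2 * (9 / 20 * (q * h)) = 720 * (((\<beta> + \<alpha>) * q / 3200) * h)"
    by (simp add: add.commute)
  moreover have "((\<beta> + \<alpha>) * q / 3200) * h \<ge> 0" using \<alpha> pq h by simp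
  ultimately show "K * h \<le> a + b" by linarith
qed

section \<open>Stability of the factor bounds under perturbation\<close>

lemma bounded_below_on_perturb:
  fixes U U0 :: "real^'k^'m"
  assumes "bounded_below_on J s U0" "norm (U - U0) \<le> d"
  shows "bounded_below_on J (s - d) U"
  unfolding bounded_below_on_def
proof (intro allI impI)
  fix c :: "real^'k" assume "\<forall>j. j \<notin> J \<longrightarrow> c$j = 0"
  then have "s * norm c \<le> norm (U0 *v c)" using assms(1) by (simp add: bounded_below_on_def)
  moreover have "norm ((U - U0) *v c) \<le> d * norm c"
    using norm_matrix_vector_le[of "U - U0" c] mult_right_mono[OF assms(2), of "norm c"] by simp
  moreover have "norm (U0 *v c) \<le> norm (U *v c) + norm ((U - U0) *v c)"
    using norm_triangle_ineq4[of "U *v c" "(U - U0) *v c"] by (simp add: matrix_vector_mult_diff_rdistrib)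
  ultimately show "(s - d) * norm c \<le> norm (U *v c)" by (simp add: algebra_simps)
qed

lemma norm_mult_perturb:
  fixes U U0 :: "real^'k^'m"
  assumes "\<And>x. norm (U0 *v x) \<le> p * norm x" "norm (U - U0) \<le> d"
  shows "norm (U *v x) \<le> (p + d) * norm x"
proof -
  have "norm (U *v x) \<le> norm (U0 *v x) + norm ((U - U0) *v x)"
    using norm_triangle_ineq[of "U0 *v x" "(U - U0) *v x"] by (simp add: matrix_vector_mult_diff_rdistrib)
  also have "\<dots> \<le> p * norm x + d * norm x"
    using norm_matrix_vector_le[of "U - U0" x] mult_right_mono[OF assms(2), of "norm x"] assms(1)[of x] by simp
  finally show ?thesis by (simp add: algebra_simps)
qed

lemma colsupp_superset:
  fixes U :: "real^'k^'m"
  assumes "bounded_below_on J s U" "s > 0" shows "J \<subseteq> colsupp U"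
proof
  fix j assume "j \<in> J"
  then have "s * norm (axis j 1 :: real^'k) \<le> norm (U *v axis j 1)"
    using assms(1) unfolding bounded_below_on_def by (auto simp: axis_def)
  then show "j \<in> colsupp U" using assms(2) by (auto simp: colsupp_def column_eq_mult_axis)
qed

theorem theorem4p1:
  fixes A :: "real^'n^'m \<Rightarrow> real^'p"
    and M :: "real^'n^'m"
    and \<sigma> :: "nat \<Rightarrow> real"
    and r :: nat
    and \<nu> \<mu> \<alpha> \<beta> \<gamma> :: real
    and Ubar U :: "real^'k^'m"
    and Vbar V :: "real^'k^'n"
  assumes "CARD('m) \<le> CARD('n)"
    and "rank M = r" and "r \<ge> 1"
    and "singular_values M \<sigma>"
    and "linear A"
    and "\<nu> > 0" and "\<mu> > 0"
    and "\<alpha> = restricted_min_eigenvalue (2 * r) A"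
    and "\<beta> = restricted_max_eigenvalue (2 * r) A"
    and "rank_reg_solutions \<nu> A M \<inter> rank_le CARD('k) \<noteq> {}"
    and "\<beta> / \<alpha> < (128 * (\<sigma> 1)\<^sup>2 * (4 * \<sigma> 1 + \<sigma> r)\<^sup>2 + (\<sigma> r)^4)
                 / (128 * (\<sigma> 1)\<^sup>2 * (4 * \<sigma> 1 + \<sigma> r)\<^sup>2 - (\<sigma> r)^4)"
    and "\<alpha> > 4 / (\<nu> * (\<sigma> r)\<^sup>2)"
    and "(Ubar, Vbar) \<in> factor_solutions \<nu> A M"
    and "norm (U - Ubar, V - Vbar) < sqrt (\<sigma> r) / 4"
    and "0 < Psi \<nu> \<mu> A M (U, V) - Psi \<nu> \<mu> A M (Ubar, Vbar)"
    and "Psi \<nu> \<mu> A M (U, V) - Psi \<nu> \<mu> A M (Ubar, Vbar) < 1 / 2"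
    and "\<gamma> = min (\<nu> / \<beta> * ((\<beta> + \<alpha>) * (\<sigma> r)^4 / (128 * sqrt ((\<sigma> 1)^3) * (4 * \<sigma> 1 + \<sigma> r)\<^sup>2)
                              - sqrt (\<sigma> 1) * (\<beta> - \<alpha>))\<^sup>2)
                 (2 * \<mu> * \<sigma> r)"
  shows "(infdist 0 (limiting_subdifferential (Psi \<nu> \<mu> A M) (U, V)))\<^sup>2
           \<ge> \<gamma> * (Psi \<nu> \<mu> A M (U, V) - Psi \<nu> \<mu> A M (Ubar, Vbar))"
proof -
  have linA: "linear A" and \<nu>: "\<nu> > 0" and \<mu>: "\<mu> > 0" by fact+
  obtain u :: "nat \<Rightarrow> real^'m" and v :: "nat \<Rightarrow> real^'n" where
    u: "orthonormal {1..r} u" and v: "orthonormal {1..r} v" and M: "M = rank_one_sum {1..r} \<sigma> u v"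
    and \<sigma>r: "\<sigma> r > 0" "\<And>i. i \<in> {1..r} \<Longrightarrow> \<sigma> r \<le> \<sigma> i" and \<sigma>1: "\<And>i. i \<in> {1..r} \<Longrightarrow> \<sigma> i \<le> \<sigma> 1"
    using thin_svd[OF assms(4,2,3)] by metis
  have \<sigma>1r: "\<sigma> r \<le> \<sigma> 1" using \<sigma>1[of r] \<open>r \<ge> 1\<close> by simp
  have bd: "\<alpha> * (norm X)\<^sup>2 \<le> (norm (A X))\<^sup>2 \<and> (norm (A X))\<^sup>2 \<le> \<beta> * (norm X)\<^sup>2"
    if "rank X \<le> 2 * r" for X
    using restricted_eigenvalue_bounds[OF linA that] assms(8,9) by simp
  have "4 / (\<nu> * (\<sigma> r)\<^sup>2) > 0" using \<nu> \<sigma>r(1) by simp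
  then have \<alpha>: "\<alpha> > 0" using assms(12) by linarith
  have M0: "M \<noteq> 0" using assms(2,3) by auto
  have "\<alpha> * (norm M)\<^sup>2 \<le> \<beta> * (norm M)\<^sup>2" using bd[of M] assms(2) by linarith
  then have \<alpha>\<beta>: "\<alpha> \<le> \<beta>" using M0 by simp
  have bar: "Ubar ** transpose Vbar \<in> rank_reg_solutions \<nu> A M"
    "transpose Ubar ** Ubar = transpose Vbar ** Vbar"
    "nonzero_columns Ubar = rank (Ubar ** transpose Vbar)"
    "nonzero_columns Vbar = rank (Ubar ** transpose Vbar)"
    using assms(13) by (auto simp: factor_solutions_def)
  have UVbar: "Ubar ** transpose Vbar = M"
    by (rule rank_reg_solution_unique[OF u v M \<sigma>r assms(2) linA \<nu> assms(8,12) bar(1)])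
  then have cols: "nonzero_columns Ubar = r" "nonzero_columns Vbar = r" using bar(3,4) assms(2) by auto
  define J where "J = colsupp Ubar"
  define s where "s = sqrt (\<sigma> r)"
  define p where "p = sqrt (\<sigma> 1)"
  have s: "s > 0" "s\<^sup>2 = \<sigma> r" using \<sigma>r(1) by (auto simp: s_def)
  have sp: "s \<le> p" using \<sigma>1r by (simp add: s_def p_def)
  note spec = factor_spectrum[OF u v \<open>r \<ge> 1\<close> UVbar[unfolded M] \<sigma>r \<sigma>1 bar(2) cols(1),
      folded J_def s_def p_def]
  have dist: "norm (U - Ubar) \<le> s / 4" "norm (V - Vbar) \<le> s / 4"
    using assms(14) norm_fst_le[of "U - Ubar" "V - Vbar"] norm_snd_le[of "V - Vbar" "U - Ubar"]
    by (simp_all add: s_def)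
  \<comment> \<open>Moving by at most \<open>s / 4\<close> lowers the bound \<open>s\<close> to
    \<open>3 / 4 * s\<close> and raises \<open>p\<close> to at most \<open>5 / 4 * p\<close>,
    because \<open>s \<le> p\<close>.\<close>
  have below: "bounded_below_on J (3 / 4 * s) U" "bounded_below_on J (3 / 4 * s) V"
    using bounded_below_on_perturb[OF spec(1) dist(1)] bounded_below_on_perturb[OF spec(2) dist(2)] by simp_all
  have above: "norm (U *v x) \<le> 5 / 4 * p * norm x" "norm (V *v y) \<le> 5 / 4 * p * norm y" for x y
  proof -
    have le: "(p + s / 4) * norm z \<le> 5 / 4 * p * norm z" for z :: "real^'k"
      using sp by (intro mult_right_mono) auto
    show "norm (U *v x) \<le> 5 / 4 * p * norm x"
      using norm_mult_perturb[OF spec(3) dist(1), of x] le[of x] by linarith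
    show "norm (V *v y) \<le> 5 / 4 * p * norm y"
      using norm_mult_perturb[OF spec(4) dist(2), of y] le[of y] by linarith
  qed

  have Psi_bar: "Psi \<nu> \<mu> A M (Ubar, Vbar) = r"
    by (simp add: Psi_def loss_def UVbar bar(2) cols)
  have cardJ: "card J = r" using cols(1) by (simp add: J_def nonzero_columns_colsupp)
  have sub: "J \<subseteq> colsupp U" "J \<subseteq> colsupp V"
    using colsupp_superset[OF below(1)] colsupp_superset[OF below(2)] s(1) by auto
  have smooth_nonneg: "smooth_part \<nu> \<mu> A M (U, V) \<ge> 0"
    using \<nu> \<mu> by (simp add: smooth_part_def loss_def)
  \<comment> \<open>The optimal value is \<open>r\<close> and the smooth part is nonnegative, so a
    gap below 1/2 leaves room for fewer than \<open>2 * r + 1\<close> nonzero columns. Each factor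
    already has the \<open>r\<close> columns in \<open>J\<close>, so neither can have more.\<close>
  have "real (card (colsupp U)) + real (card (colsupp V)) < 2 * real r + 1"
    using assms(16) smooth_nonneg unfolding Psi_bar unfolding Psi_smooth_part fst_conv snd_conv by argo
  then have "real (card (colsupp U) + card (colsupp V)) < real (2 * r + 1)" by simp
  then have "card (colsupp U) + card (colsupp V) < 2 * r + 1" by (simp only: of_nat_less_iff)
  moreover have "r \<le> card (colsupp U)" "r \<le> card (colsupp V)"
    using sub cardJ by (auto intro: card_mono)
  ultimately have "card J = card (colsupp U)" "card J = card (colsupp V)"
    unfolding cardJ by auto
  then have supp: "colsupp U = J" "colsupp V = J"
    using card_subset_eq[OF finite sub(1)] card_subset_eq[OF finite sub(2)] by blast+
  have Psi_diff: "Psi \<nu> \<mu> A M (U, V) - Psi \<nu> \<mu> A M (Ubar, Vbar) = smooth_part \<nu> \<mu> A M (U, V)"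
    unfolding Psi_bar by (simp add: Psi_smooth_part supp cardJ)
  have colU: "column j U = 0" and colV: "column j V = 0" and colVbar: "column j Vbar = 0" if "j \<notin> J" for j
    using that supp spec(5) by (auto simp: colsupp_def)

  define H where "H = U ** transpose V - M"
  define G where "G = adjoint A (A H)"
  define E where "E = transpose U ** U - transpose V ** V"
  define K where "K = (\<beta> + \<alpha>) * (\<sigma> r)^4 / (128 * sqrt ((\<sigma> 1)^3) * (4 * \<sigma> 1 + \<sigma> r)\<^sup>2) - sqrt (\<sigma> 1) * (\<beta> - \<alpha>)"
  have rankU: "rank U \<le> r" and rankV: "rank V \<le> r"
    using rank_le_nonzero_columns[of U] rank_le_nonzero_columns[of V]
    by (simp_all add: nonzero_columns_colsupp supp cardJ)
  have GX: "G \<bullet> X = A H \<bullet> A X" for X by (simp add: G_def adjoint_clauses(2)[OF linA])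
  have p0: "5 / 4 * p \<ge> 0" using s(1) sp by simp
  have GV: "(\<alpha> + \<beta>) / 2 * norm (H ** V) \<le> norm (G ** V) + (\<beta> - \<alpha>) / 2 * (5 / 4 * p * norm H)"
    by (rule gradient_factor_lower_bound[OF linA bd \<alpha>\<beta> H_def _ rankV GX above(2) p0]) (simp_all add: assms(2))
  \<comment> \<open>The previous bound for the transposed problem: the roles of \<open>U\<close> and
    \<open>V\<close> are exchanged and \<open>A\<close> is precomposed with
    \<open>transpose\<close>.\<close>
  have GU: "(\<alpha> + \<beta>) / 2 * norm (transpose H ** U)
      \<le> norm (transpose G ** U) + (\<beta> - \<alpha>) / 2 * (5 / 4 * p * norm H)"
  proof -
    have "linear (\<lambda>X. A (transpose X))"
      using linear_compose[OF bounded_linear.linear[OF bounded_linear_transpose] linA] by (simp add: o_def)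
    moreover have "\<alpha> * (norm X)\<^sup>2 \<le> (norm (A (transpose X)))\<^sup>2 \<and> (norm (A (transpose X)))\<^sup>2 \<le> \<beta> * (norm X)\<^sup>2"
      if "rank X \<le> 2 * r" for X
      using bd[of "transpose X"] that by (simp add: rank_transpose norm_transpose)
    moreover have "transpose H = V ** transpose U - transpose M"
      by (simp add: H_def transpose_diff matrix_transpose_mul)
    moreover have "transpose G \<bullet> X = A (transpose (transpose H)) \<bullet> A (transpose X)" for X
      using inner_transpose[of G "transpose X"] by (simp add: GX)
    ultimately have "(\<alpha> + \<beta>) / 2 * norm (transpose H ** U)
      \<le> norm (transpose G ** U) + (\<beta> - \<alpha>) / 2 * (5 / 4 * p * norm (transpose H))"
      by (intro gradient_factor_lower_bound[where A="\<lambda>X. A (transpose X)" and r=r and M="transpose M" and U=V])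
         (use \<alpha>\<beta> rankU above(1) p0 assms(2) in \<open>simp_all add: rank_transpose\<close>)
    then show ?thesis by (simp add: norm_transpose)
  qed
  have "3 / 4 * s * norm H \<le> 5 / 3 * (norm (H ** V) + norm (transpose H ** U))"
    unfolding H_def UVbar[symmetric]
    by (rule factor_error_bound[OF colU colV colVbar below _ spec(1) s(1) dist(1)]) (use s in auto)
  note K = gradient_constant_bound[OF \<sigma>r(1) \<sigma>1r \<alpha> \<alpha>\<beta> assms(11) GV[unfolded p_def] GU[unfolded p_def]
      this[unfolded s_def] norm_ge_zero, folded K_def]

  have loss: "loss A M (U ** transpose V) \<le> \<beta> / 2 * (norm H)\<^sup>2"
  proof -
    have "rank H \<le> 2 * r"
      unfolding H_def
      using rank_diff_le[of "U ** transpose V" M] rank_mul_le_left[of U "transpose V"] rankU assms(2) by simp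
    then show ?thesis using bd[of H] by (simp add: loss_def H_def linear_diff[OF linA])
  qed
  have "K\<^sup>2 / \<beta> * loss A M (U ** transpose V) \<le> K\<^sup>2 / \<beta> * (\<beta> / 2 * (norm H)\<^sup>2)"
    using loss \<alpha> \<alpha>\<beta> by (intro mult_left_mono) auto
  also have "\<dots> = (K * norm H)\<^sup>2 / 2" using \<alpha> \<alpha>\<beta> by (simp add: power_mult_distrib)
  \<comment> \<open>Squaring is legitimate because \<open>K\<close> is nonnegative. The factor 1/2
    from the bound on the loss pays for
    \<open>(a + b)\<^sup>2 \<le> 2 * (a\<^sup>2 + b\<^sup>2)\<close>.\<close>
  also have "\<dots> \<le> (norm (G ** V) + norm (transpose G ** U))\<^sup>2 / 2"
    using K by (intro divide_right_mono power_mono) auto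
  also have "\<dots> \<le> (norm (G ** V))\<^sup>2 + (norm (transpose G ** U))\<^sup>2"
    using sum_squares_bound[of "norm (G ** V)" "norm (transpose G ** U)"] by (simp add: power2_sum)
  finally have "\<nu>\<^sup>2 * (K\<^sup>2 / \<beta> * loss A M (U ** transpose V))
      \<le> \<nu>\<^sup>2 * ((norm (G ** V))\<^sup>2 + (norm (transpose G ** U))\<^sup>2)"
    by (rule mult_left_mono) simp
  moreover have "\<gamma> * (\<nu> * loss A M (U ** transpose V)) \<le> \<nu> / \<beta> * K\<^sup>2 * (\<nu> * loss A M (U ** transpose V))"
    using \<nu> unfolding assms(17) K_def by (intro mult_right_mono) (auto simp: loss_def)
  ultimately have part1: "\<gamma> * (\<nu> * loss A M (U ** transpose V))
      \<le> \<nu>\<^sup>2 * ((norm (G ** V))\<^sup>2 + (norm (transpose G ** U))\<^sup>2)"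
    by (simp add: power2_eq_square mult_ac)

  have E0: "E $ i $ j = 0" if "i \<notin> J" for i j
    using colU[OF that] colV[OF that]
    by (simp add: E_def matrix_matrix_mult_def transpose_def column_eq_0_iff)
  have "3 / 4 * s * norm E \<le> norm (U ** E)" "3 / 4 * s * norm E \<le> norm (V ** E)"
    using norm_mult_ge[OF below(1) _ E0] norm_mult_ge[OF below(2) _ E0] s(1) by auto
  then have "(3 / 4 * s * norm E)\<^sup>2 \<le> (norm (U ** E))\<^sup>2" "(3 / 4 * s * norm E)\<^sup>2 \<le> (norm (V ** E))\<^sup>2"
    using s(1) by (auto intro!: power_mono)
  then have "9 / 8 * \<sigma> r * (norm E)\<^sup>2 \<le> (norm (U ** E))\<^sup>2 + (norm (V ** E))\<^sup>2"
    by (simp add: power_mult_distrib s(2) power_divide)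
  \<comment> \<open>9/8 is twice the square of 3/4. The target 1/2 arises since the entry
    \<open>2 * \<mu> * \<sigma> r\<close> of \<gamma>, times the weight \<open>\<mu> / 4\<close>, is
    \<open>\<mu>\<^sup>2 * \<sigma> r / 2\<close>.\<close>
  moreover have "1 / 2 * \<sigma> r * (norm E)\<^sup>2 \<le> 9 / 8 * \<sigma> r * (norm E)\<^sup>2"
    using \<sigma>r(1) by (intro mult_right_mono) auto
  ultimately have "\<mu>\<^sup>2 * (1 / 2 * \<sigma> r * (norm E)\<^sup>2) \<le> \<mu>\<^sup>2 * ((norm (U ** E))\<^sup>2 + (norm (V ** E))\<^sup>2)"
    by (intro mult_left_mono) auto
  moreover have "\<gamma> * (\<mu> / 4 * (norm E)\<^sup>2) \<le> 2 * \<mu> * \<sigma> r * (\<mu> / 4 * (norm E)\<^sup>2)"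
    using \<mu> unfolding assms(17) by (intro mult_right_mono) auto
  moreover have "2 * \<mu> * \<sigma> r * (\<mu> / 4 * (norm E)\<^sup>2) = \<mu>\<^sup>2 * (1 / 2 * \<sigma> r * (norm E)\<^sup>2)"
    by (simp add: power2_eq_square)
  ultimately have part2: "\<gamma> * (\<mu> / 4 * (norm E)\<^sup>2) \<le> \<mu>\<^sup>2 * ((norm (U ** E))\<^sup>2 + (norm (V ** E))\<^sup>2)"
    by linarith

  have "\<gamma> * smooth_part \<nu> \<mu> A M (U, V) \<le> (norm (smooth_gradient \<nu> \<mu> A M (U, V)))\<^sup>2"
    using add_mono[OF part1 part2]
    by (simp add: smooth_part_def norm_smooth_gradient distrib_left E_def G_def H_def linear_diff[OF linA])
  also have "\<dots> \<le> (infdist 0 (limiting_subdifferential (Psi \<nu> \<mu> A M) (U, V)))\<^sup>2"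
    by (intro power_mono infdist_limiting_subdifferential_Psi[OF linA supp]) simp
  finally show ?thesis unfolding Psi_diff .
qed

end
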